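(* Let $G=\mathbb{R}^2\rtimes\mathbb{R}^+$, where the multiplicative group $\mathbb{R}^+$ acts by scalar multiplication, and let $\pi$ be the (reducible) quasi-regular representation of $G$ on $L^2(\mathbb{R}^2)$. There exist functions $f,g\in L^2(\mathbb{R}^2)$ with the following properties: (i) The wavelet transforms $\mathcal{W}_f,\mathcal{W}_g:L^2(\mathbb{R}^2)\to L^2(G)$ are both well-defined and isometric. (ii) $\mathcal{W}_gg=\mathcal{W}_ff\in L^1_v(G)$ for any continuous weight $v$ on $G$ of the form $v(x,s)=v_0(s)$. (iii) $\mathcal{W}_fg\notin L^1_v(G)$ for any such weight $v$. In particular, the coorbit spaces $\mathrm{Co}(L^1_v(G))$ defined using either $f$ or $g$ as analyzing wavelet do not coincide: $\{\varphi\in L^2(\mathbb{R}^2):\mathcal{W}_f\varphi\in L^1_v(G)\}\ne\{\varphi\in L^2(\mathbb{R}^2):\mathcal{W}_g\varphi\in L^1_v(G)\}$.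
   Context: $G=\mathbb{R}^2\rtimes\mathbb{R}^+$ has product $(x,s)(y,r)=(x+sy,sr)$ and left Haar measure $s^{-2}\,dx\,\frac{ds}{s}$. The quasi-regular representation is $[\pi(x,s)f](y)=s^{-1}f(s^{-1}(y-x))$ on $L^2(\mathbb{R}^2)$, and $\mathcal{W}_\psi\varphi(x,s)=\langle\varphi,\pi(x,s)\psi\rangle$. A weight on $G$ is a continuous positive function $v$ with $v(z_1z_2)\le v(z_1)v(z_2)$. $L^1_v(G)$ is the space of measurable $F$ on $G$ with $\int_G|F|\,v<\infty$ with respect to left Haar measure. *)

theory Defs
  imports "HOL-Analysis.Analysis"
begin

text \<open>The group \<open>\<real>\<^sup>2 \<rtimes> \<real>\<^sup>+\<close> is the carrier \<open>affG\<close> inside \<open>real^2 \<times> real\<close>; only values at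
  points of \<open>affG\<close> are ever relevant for functions on the group.\<close>

definition affG :: "((real^2) \<times> real) set" where
  "affG = {(x, s). s > 0}"

definition affG_mult :: "(real^2) \<times> real \<Rightarrow> (real^2) \<times> real \<Rightarrow> (real^2) \<times> real" where
  "affG_mult z w = (fst z + snd z *\<^sub>R fst w, snd z * snd w)"

definition affG_haar :: "((real^2) \<times> real) measure" where
  "affG_haar = density (restrict_space lborel affG) (\<lambda>(x, s). ennreal (1 / s^2 * (1 / s)))"

text \<open>Elements of \<open>L\<^sup>2\<close> are represented by measurable functions. For \<open>M = lborel\<close> these are Borel
  functions; every \<open>L\<^sup>2\<close>-class of Lebesgue measurable functions has such a representative.\<close>

definition L2_fun :: "'a measure \<Rightarrow> ('a \<Rightarrow> complex) set" where
  "L2_fun M = {f \<in> borel_measurable M. integrable M (\<lambda>x. (cmod (f x))^2)}"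

definition L2_norm :: "'a measure \<Rightarrow> ('a \<Rightarrow> complex) \<Rightarrow> real" where
  "L2_norm M f = sqrt (\<integral>x. (cmod (f x))^2 \<partial>M)"

definition L2_inner :: "'a measure \<Rightarrow> ('a \<Rightarrow> complex) \<Rightarrow> ('a \<Rightarrow> complex) \<Rightarrow> complex" where
  "L2_inner M f g = (\<integral>x. f x * cnj (g x) \<partial>M)"

definition quasi_regular :: "(real^2) \<times> real \<Rightarrow> (real^2 \<Rightarrow> complex) \<Rightarrow> real^2 \<Rightarrow> complex" where
  "quasi_regular z f y = complex_of_real (1 / snd z) * f ((1 / snd z) *\<^sub>R (y - fst z))"

definition wavelet_transform ::
    "(real^2 \<Rightarrow> complex) \<Rightarrow> (real^2 \<Rightarrow> complex) \<Rightarrow> (real^2) \<times> real \<Rightarrow> complex" where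
  "wavelet_transform \<psi> \<phi> z = L2_inner lborel \<phi> (quasi_regular z \<psi>)"

text \<open>\<open>wavelet_transform \<psi>\<close> is linear on \<open>L\<^sup>2(\<real>\<^sup>2)\<close>, so being isometric means preserving the norm.\<close>

definition isometric_wavelet :: "(real^2 \<Rightarrow> complex) \<Rightarrow> bool" where
  "isometric_wavelet \<psi> \<longleftrightarrow>
     (\<forall>\<phi> \<in> L2_fun lborel. wavelet_transform \<psi> \<phi> \<in> L2_fun affG_haar \<and>
        L2_norm affG_haar (wavelet_transform \<psi> \<phi>) = L2_norm lborel \<phi>)"

definition affG_weight :: "((real^2) \<times> real \<Rightarrow> real) \<Rightarrow> bool" where
  "affG_weight v \<longleftrightarrow> continuous_on affG v \<and> (\<forall>z\<in>affG. v z > 0) \<and>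
     (\<forall>z\<in>affG. \<forall>w\<in>affG. v (affG_mult z w) \<le> v z * v w)"

definition scale_weight :: "((real^2) \<times> real \<Rightarrow> real) \<Rightarrow> bool" where
  "scale_weight v \<longleftrightarrow> affG_weight v \<and> (\<exists>v\<^sub>0 :: real \<Rightarrow> real. \<forall>x. \<forall>s>0. v (x, s) = v\<^sub>0 s)"

definition weighted_L1 :: "((real^2) \<times> real \<Rightarrow> real) \<Rightarrow> ((real^2) \<times> real \<Rightarrow> complex) set" where
  "weighted_L1 v =
     {F \<in> borel_measurable affG_haar. integrable affG_haar (\<lambda>z. cmod (F z) * v z)}"

definition coorbit_L1 ::
    "(real^2 \<Rightarrow> complex) \<Rightarrow> ((real^2) \<times> real \<Rightarrow> real) \<Rightarrow> (real^2 \<Rightarrow> complex) set" where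
  "coorbit_L1 \<psi> v = {\<phi> \<in> L2_fun lborel. wavelet_transform \<psi> \<phi> \<in> weighted_L1 v}"

end

theory Submission
  imports Defs "HOL-Probability.Characteristic_Functions"
begin

text \<open>On the Fourier side a wavelet transform is a multiplication. If \<open>\<psi>\<close> and \<open>\<phi>\<close> are the Fourier
  transforms of \<open>\<Psi>\<close> and \<open>\<Phi>\<close>, then \<open>x \<mapsto> wavelet_transform \<psi> \<phi> (x, s)\<close> is, up to a constant, the Fourier
  transform of \<open>\<eta> \<mapsto> s \<cdot> \<Phi>(\<eta>) \<cdot> cnj (\<Psi>(s\<eta>))\<close> (\<open>wavelet_transform_of_ft\<close>). By Plancherel the transform
  is therefore isometric as soon as the integral of \<open>\<bar>\<Psi>(s\<eta>)\<bar>\<^sup>2 ds/s\<close> over \<open>s > 0\<close> has the right value for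
  every \<open>\<eta> \<noteq> 0\<close> (\<open>isometric_wavelet_ft\<close>). Multiplying \<open>\<Psi>\<close> by a unimodular function that is
  homogeneous of degree \<open>0\<close> changes neither this integral nor \<open>\<Psi>(\<eta>) \<cdot> cnj (\<Psi>(s\<eta>))\<close>, and hence not
  the transform of \<open>\<psi>\<close> with respect to itself.

  So let \<open>F\<close> be a continuous radial function supported in an annulus, normalised to be admissible,
  and let \<open>G\<close> be \<open>F\<close> times the sign of the first coordinate; \<open>f\<close> and \<open>g\<close> are the Fourier transforms
  of \<open>F\<close> and \<open>G\<close>. Both wavelet transforms are isometric and they agree on the diagonal.
  The supports of \<open>F\<close> and \<open>F(s\<cdot>)\<close> are disjoint unless \<open>s\<close> lies in a compact subset of \<open>(0, \<infinity>)\<close>, on which a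
  weight depending on \<open>s\<close> alone is bounded. Therefore the transform of \<open>f\<close> with respect to itself is in
  every weighted \<open>L\<^sup>1\<close> space as soon as \<open>f\<close> is integrable (\<open>wavelet_FF_weighted_L1\<close>). To get this without
  differentiating \<open>F\<close>, it is chosen as a convolution of two indicator functions: then \<open>f\<close>
  is a product of two square integrable functions (\<open>integrable_ft_Fhat\<close>).
  On the other hand, for \<open>s\<close> near \<open>1\<close> the function \<open>G(\<eta>) \<cdot> cnj (F(s\<eta>))\<close> jumps across the line \<open>\<eta>\<^sub>1 = 0\<close>.
  Its Fourier transform cannot be integrable, because the inversion formula would make it continuous
  (\<open>not_integrable_slice\<close>). This happens for a set of \<open>s\<close> of positive measure, and so the transform
  of \<open>g\<close> with respect to \<open>f\<close> is in no weighted \<open>L\<^sup>1\<close> space.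

  The Fourier analysis rests on one limit, \<open>gauss_summability\<close>: the Gaussian means of the inverse
  transform of an integrable bounded function \<open>A\<close> converge to \<open>A\<close> at each point of continuity. Applied
  to a convolution \<open>h * k\<^sup>~\<close> at the origin it gives Parseval's identity, applied to \<open>h\<close> itself
  it gives the inversion formula.\<close>

section \<open>Gaussian summability of the Fourier transform\<close>

lemma nn_integral_lborel_affine:
  fixes f :: "'a::euclidean_space \<Rightarrow> ennreal"
  assumes [measurable]: "f \<in> borel_measurable borel" and c: "c \<noteq> 0"
  shows "(\<integral>\<^sup>+x. f x \<partial>lborel) = ennreal (\<bar>c\<bar> ^ DIM('a)) * (\<integral>\<^sup>+x. f (t + c *\<^sub>R x) \<partial>lborel)"
  by (subst lborel_affine[OF c, of t])
     (simp add: nn_integral_density nn_integral_distr nn_integral_cmult)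

lemma integrable_lborel_affine_iff:
  fixes f :: "'a::euclidean_space \<Rightarrow> 'b::{banach, second_countable_topology}"
  assumes c: "c \<noteq> 0"
  shows "integrable lborel (\<lambda>x. f (t + c *\<^sub>R x)) \<longleftrightarrow> integrable lborel f"
proof -
  have *: "integrable lborel (\<lambda>x. f (t + c *\<^sub>R x))"
    if f: "integrable lborel f" and c: "c \<noteq> 0" for f :: "'a \<Rightarrow> 'b" and c t
  proof -
    have [measurable]: "f \<in> borel_measurable borel"
      using f by auto
    have "integrable (density (distr lborel borel (\<lambda>x. t + c *\<^sub>R x)) (\<lambda>_. ennreal (\<bar>c\<bar>^DIM('a)))) f"
      using f lborel_affine[OF c, of t] by simp
    then have "integrable (distr lborel borel (\<lambda>x. t + c *\<^sub>R x)) (\<lambda>x. \<bar>c\<bar>^DIM('a) *\<^sub>R f x)"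
      by (subst (asm) integrable_density) auto
    then have "integrable lborel (\<lambda>x. \<bar>c\<bar>^DIM('a) *\<^sub>R f (t + c *\<^sub>R x))"
      by (simp add: integrable_distr_eq)
    then have "integrable lborel (\<lambda>x. (1 / \<bar>c\<bar>^DIM('a)) *\<^sub>R \<bar>c\<bar>^DIM('a) *\<^sub>R f (t + c *\<^sub>R x))"
      by (rule integrable_scaleR_right)
    moreover have "(1 / \<bar>c\<bar>^DIM('a)) *\<^sub>R \<bar>c\<bar>^DIM('a) *\<^sub>R v = v" for v :: 'b
      using c by simp
    ultimately show ?thesis
      by (simp only:)
  qed
  show ?thesis
  proof
    assume "integrable lborel (\<lambda>x. f (t + c *\<^sub>R x))"
    from *[OF this, of "1/c" "- (1/c) *\<^sub>R t"] c show "integrable lborel f"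
      by (simp add: algebra_simps)
  qed (use * c in blast)
qed

lemma integral_lborel_affine:
  fixes f :: "'a::euclidean_space \<Rightarrow> 'b::{banach, second_countable_topology}"
  assumes c: "c \<noteq> 0"
  shows "(\<integral>x. f x \<partial>lborel) = \<bar>c\<bar> ^ DIM('a) *\<^sub>R (\<integral>x. f (t + c *\<^sub>R x) \<partial>lborel)"
proof (cases "integrable lborel f")
  case True
  then have [measurable]: "f \<in> borel_measurable borel" by auto
  show ?thesis
    by (subst lborel_affine[OF c, of t]) (simp add: integral_density integral_distr)
next
  case False
  then show ?thesis
    using integrable_lborel_affine_iff[OF c, of f t] by (simp add: not_integrable_integral_eq)
qed

definition gauss :: "'a::euclidean_space \<Rightarrow> real" where
  "gauss x = exp (- (norm x)\<^sup>2 / 2)"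

lemma gauss_measurable [measurable]: "gauss \<in> borel_measurable borel"
  unfolding gauss_def by measurable

text \<open>The Gaussian is a product of one-dimensional Gaussians, which reduces its Fourier transform to the
  characteristic function of the standard normal distribution.\<close>

lemma gauss_prod: "gauss (x::'a::euclidean_space) = (\<Prod>b\<in>Basis. exp (- (x \<bullet> b)\<^sup>2 / 2))"
proof -
  have "(norm x)\<^sup>2 = (\<Sum>b\<in>Basis. (x \<bullet> b)\<^sup>2)"
    by (subst power2_norm_eq_inner, subst euclidean_inner) (simp add: power2_eq_square)
  then show ?thesis
    by (simp add: gauss_def exp_sum[symmetric] sum_negf sum_divide_distrib)
qed

lemma exp_sq_eq_normal: "exp (- x\<^sup>2 / 2) = sqrt (2 * pi) * std_normal_density x"
  by (simp add: std_normal_density_def)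

lemma integrable_lborel_prod:
  fixes f :: "'a::euclidean_space \<Rightarrow> real \<Rightarrow> complex"
  assumes "\<And>b. b \<in> Basis \<Longrightarrow> integrable lborel (f b)"
  shows "integrable lborel (\<lambda>x::'a. \<Prod>b\<in>Basis. f b (x \<bullet> b))" (is ?A)
    and "integral\<^sup>L lborel (\<lambda>x::'a. \<Prod>b\<in>Basis. f b (x \<bullet> b)) = (\<Prod>b\<in>Basis. \<integral>x. f b x \<partial>lborel)" (is ?B)
proof -
  interpret product_sigma_finite "\<lambda>_::'a. lborel :: real measure" ..
  have [measurable]: "\<And>b. b \<in> Basis \<Longrightarrow> f b \<in> borel_measurable borel"
    using assms by fastforce
  have *: "(\<Prod>b\<in>Basis. f b ((\<Sum>b\<in>Basis. g b *\<^sub>R b) \<bullet> b)) = (\<Prod>b\<in>Basis. f b (g b))" for g :: "'a \<Rightarrow> real"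
    by (intro prod.cong) auto
  show ?A
    by (subst lborel_eq, subst integrable_distr_eq)
       (use assms in \<open>auto simp: * intro!: product_integrable_prod\<close>)
  show ?B
    by (subst lborel_eq, subst integral_distr)
       (use assms in \<open>auto simp: * intro!: product_integral_prod\<close>)
qed

lemma gauss_ft_1: 
  "integrable lborel (\<lambda>x. cis (x * t) * of_real (exp (- x\<^sup>2 / 2)))"
  "(\<integral>x. cis (x * t) * of_real (exp (- x\<^sup>2 / 2)) \<partial>lborel) = of_real (sqrt (2*pi) * exp (- t\<^sup>2 / 2))"
proof -
  have i: "integrable lborel (\<lambda>x. exp (- x\<^sup>2 / 2) :: real)"
    unfolding exp_sq_eq_normal
    using integrable_std_normal_distribution_moment[of 0]
    by (intro integrable_mult_right) (simp add: integrable_density)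
  show "integrable lborel (\<lambda>x. cis (x * t) * of_real (exp (- x\<^sup>2 / 2)))"
    by (rule Bochner_Integration.integrable_bound[OF i]) (auto simp: norm_mult cis_conv_exp)
  have "(\<integral>x. std_normal_density x *\<^sub>R iexp (t * x) \<partial>lborel) = of_real (exp (- t\<^sup>2 / 2))"
    using fun_cong[OF char_std_normal_distribution, of t]
    by (simp add: char_def integral_density)
  then have "complex_of_real (sqrt (2*pi)) * (\<integral>x. std_normal_density x *\<^sub>R iexp (t * x) \<partial>lborel)
     = of_real (sqrt (2*pi) * exp (- t\<^sup>2 / 2))" by simp
  then show "(\<integral>x. cis (x * t) * of_real (exp (- x\<^sup>2 / 2)) \<partial>lborel) = of_real (sqrt (2*pi) * exp (- t\<^sup>2 / 2))"
    unfolding exp_sq_eq_normal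
    by (subst (asm) integral_mult_right_zero[symmetric])
       (simp add: cis_conv_exp scaleR_conv_of_real mult_ac del: integral_mult_right_zero real_sqrt_mult)
qed

lemma gauss_ft:
  fixes \<xi> :: "'a::euclidean_space"
  shows "integrable lborel (\<lambda>x. cis (x \<bullet> \<xi>) * of_real (gauss x))"
    and "(\<integral>x. cis (x \<bullet> \<xi>) * of_real (gauss x) \<partial>lborel) = of_real (sqrt (2*pi) ^ DIM('a) * gauss \<xi>)"
proof -
  have *: "cis (x \<bullet> \<xi>) * of_real (gauss x) = (\<Prod>b\<in>Basis. cis ((x \<bullet> b) * (\<xi> \<bullet> b)) * of_real (exp (- (x \<bullet> b)\<^sup>2 / 2)))" for x
    unfolding gauss_prod prod.distrib of_real_prod cis_conv_exp 
    by (subst euclidean_inner) (simp add: sum_distrib_left exp_sum)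
  show "integrable lborel (\<lambda>x. cis (x \<bullet> \<xi>) * of_real (gauss x))"
    unfolding * by (rule integrable_lborel_prod) (rule gauss_ft_1)
  have "(\<integral>x. cis (x \<bullet> \<xi>) * of_real (gauss x) \<partial>lborel) 
    = (\<Prod>b\<in>Basis. (\<integral>x. cis (x * (\<xi> \<bullet> b)) * of_real (exp (- x\<^sup>2 / 2)) \<partial>lborel))"
    unfolding * by (rule integrable_lborel_prod) (rule gauss_ft_1)
  also have "\<dots> = (\<Prod>b\<in>(Basis::'a set). of_real (sqrt (2*pi) * exp (- (\<xi> \<bullet> b)\<^sup>2 / 2)))"
    by (intro prod.cong refl gauss_ft_1)
  also have "\<dots> = of_real (sqrt (2*pi) ^ DIM('a) * gauss \<xi>)"
    unfolding gauss_prod of_real_prod[symmetric] prod.distrib by simp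
  finally show "(\<integral>x. cis (x \<bullet> \<xi>) * of_real (gauss x) \<partial>lborel) = of_real (sqrt (2*pi) ^ DIM('a) * gauss \<xi>)" .
qed

lemma gauss_integrable: "integrable lborel (gauss :: 'a::euclidean_space \<Rightarrow> real)"
  and gauss_integral: "(\<integral>x. gauss (x::'a::euclidean_space) \<partial>lborel) = sqrt (2*pi) ^ DIM('a)"
proof -
  show "integrable lborel (gauss :: 'a \<Rightarrow> real)"
    using gauss_ft(1)[of "0::'a"] unfolding inner_zero_right cis_zero mult_1_left complex_of_real_integrable_eq .
  show "(\<integral>x. gauss (x::'a) \<partial>lborel) = sqrt (2*pi) ^ DIM('a)"
    using gauss_ft(2)[of "0::'a"] unfolding inner_zero_right cis_zero mult_1_left integral_complex_of_real of_real_eq_iff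
    by (simp add: gauss_def[of "0::'a"])
qed

text \<open>The kernel has no factor \<open>2\<pi>\<close> and a positive sign, as for characteristic functions; the powers of
  \<open>2\<pi>\<close> below all come from this normalisation.\<close>

definition ft :: "('a::euclidean_space \<Rightarrow> complex) \<Rightarrow> 'a \<Rightarrow> complex" where
  "ft h x = (\<integral>\<xi>. h \<xi> * cis (x \<bullet> \<xi>) \<partial>lborel)"

lemma integrable_mult_cis:
  assumes "integrable lborel (h :: 'a::euclidean_space \<Rightarrow> complex)" "t \<in> borel_measurable borel"
  shows "integrable lborel (\<lambda>\<xi>. h \<xi> * cis (t \<xi>))"
proof (rule Bochner_Integration.integrable_bound[OF assms(1)])
  note assms(2)[measurable]
  have [measurable]: "h \<in> borel_measurable borel" using assms(1) by auto
  show "(\<lambda>\<xi>. h \<xi> * cis (t \<xi>)) \<in> borel_measurable lborel" by (simp add: cis_conv_exp) measurable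
qed (auto simp: norm_mult)

lemma cis_measurable [measurable]: "cis \<in> borel_measurable borel"
  by (intro borel_measurable_continuous_onI continuous_intros)

lemma ft_measurable [measurable]:
  assumes [measurable]: "h \<in> borel_measurable borel"
  shows "ft h \<in> borel_measurable borel"
  unfolding ft_def by measurable

text \<open>By Fubini the Gaussian mean equals the average of \<open>A\<close> over a Gaussian of width
  \<open>1/(n + 1)\<close> centred at \<open>p\<close>, and such averages converge to \<open>A p\<close> by dominated convergence.\<close>

lemma gauss_summability:
  fixes A :: "'a::euclidean_space \<Rightarrow> complex"
  assumes A: "integrable lborel A" and B: "\<And>x. cmod (A x) \<le> B" and cont: "isCont A p"
  shows "(\<lambda>n. \<integral>x. ft A x * cis (- (x \<bullet> p)) * of_real (gauss (x /\<^sub>R real (Suc n))) \<partial>lborel)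
     \<longlonglongrightarrow> (2*pi) ^ DIM('a) * A p"
proof -
  have [measurable]: "A \<in> borel_measurable borel" using A by auto
  define c where "c = sqrt (2*pi) ^ DIM('a)"
  have eq: "(\<integral>x. ft A x * cis (- (x \<bullet> p)) * of_real (gauss (x /\<^sub>R r)) \<partial>lborel)
      = of_real c * (\<integral>z. A (p + (1/r) *\<^sub>R z) * of_real (gauss z) \<partial>lborel)" if r: "r > 0" for r :: real
  proof -
    have gi: "integrable lborel (\<lambda>x::'a. gauss (x /\<^sub>R r))"
      using integrable_lborel_affine_iff[of "1/r" gauss "0::'a"] r gauss_integrable
      by (simp add: divide_inverse)
    have gft: "(\<integral>x. cis (x \<bullet> y) * of_real (gauss (x /\<^sub>R r)) \<partial>lborel) = of_real (r ^ DIM('a) * c * gauss (r *\<^sub>R y))" for y :: 'a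
      using r gauss_ft(2)[of "r *\<^sub>R y"]
      by (subst integral_lborel_affine[where c=r and t=0]) (auto simp: c_def scaleR_conv_of_real mult_ac)
    have int: "integrable (lborel \<Otimes>\<^sub>M lborel) (\<lambda>(x, \<xi>). A \<xi> * cis (x \<bullet> (\<xi> - p)) * of_real (gauss (x /\<^sub>R r)))"
    proof (rule lborel_pair.Fubini_integrable)
      have "(\<lambda>x. LINT y|lborel. norm (case (x, y) of (x, \<xi>) \<Rightarrow> A \<xi> * cis (x \<bullet> (\<xi> - p)) * complex_of_real (gauss (x /\<^sub>R r))))
         = (\<lambda>x. (LINT y|lborel. norm (A y)) * gauss (x /\<^sub>R r))"
        by (simp add: norm_mult gauss_def)
      with gi show "integrable lborel (\<lambda>x. LINT y|lborel. norm (case (x, y) of (x, \<xi>) \<Rightarrow> A \<xi> * cis (x \<bullet> (\<xi> - p)) * complex_of_real (gauss (x /\<^sub>R r))))"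
        by simp
      show "AE x in lborel. integrable lborel (\<lambda>y. case (x, y) of (x, \<xi>) \<Rightarrow> A \<xi> * cis (x \<bullet> (\<xi> - p)) * complex_of_real (gauss (x /\<^sub>R r)))"
        using A by (auto intro!: integrable_mult_left integrable_mult_cis)
    qed measurable
    have "(\<integral>x. ft A x * cis (- (x \<bullet> p)) * of_real (gauss (x /\<^sub>R r)) \<partial>lborel)
      = (\<integral>x. (\<integral>\<xi>. A \<xi> * cis (x \<bullet> (\<xi> - p)) * of_real (gauss (x /\<^sub>R r)) \<partial>lborel) \<partial>lborel)"
    proof (intro Bochner_Integration.integral_cong refl)
      fix x :: 'a
      have "cis (x \<bullet> (\<xi> - p)) = cis (x \<bullet> \<xi>) * cis (- (x \<bullet> p))" for \<xi>
        by (simp add: inner_diff_right cis_mult)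
      then show "ft A x * cis (- (x \<bullet> p)) * of_real (gauss (x /\<^sub>R r))
         = (\<integral>\<xi>. A \<xi> * cis (x \<bullet> (\<xi> - p)) * of_real (gauss (x /\<^sub>R r)) \<partial>lborel)"
        unfolding ft_def by (simp only: integral_mult_left_zero[symmetric] mult.assoc)
    qed
    also have "\<dots> = (\<integral>\<xi>. (\<integral>x. A \<xi> * cis (x \<bullet> (\<xi> - p)) * of_real (gauss (x /\<^sub>R r)) \<partial>lborel) \<partial>lborel)"
      by (rule lborel_pair.Fubini_integral[symmetric]) (use int in simp)
    also have "\<dots> = (\<integral>\<xi>. of_real (r ^ DIM('a) * c) * (A \<xi> * of_real (gauss (r *\<^sub>R (\<xi> - p)))) \<partial>lborel)"
    proof (intro Bochner_Integration.integral_cong refl)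
      fix \<xi>
      have "(\<integral>x. A \<xi> * cis (x \<bullet> (\<xi> - p)) * of_real (gauss (x /\<^sub>R r)) \<partial>lborel)
        = A \<xi> * (\<integral>x. cis (x \<bullet> (\<xi> - p)) * of_real (gauss (x /\<^sub>R r)) \<partial>lborel)"
        by (simp only: mult.assoc integral_mult_right_zero)
      then show "(\<integral>x. A \<xi> * cis (x \<bullet> (\<xi> - p)) * of_real (gauss (x /\<^sub>R r)) \<partial>lborel)
        = of_real (r ^ DIM('a) * c) * (A \<xi> * of_real (gauss (r *\<^sub>R (\<xi> - p))))"
        by (simp add: gft)
    qed
    also have "\<dots> = of_real (r ^ DIM('a) * c) * (\<integral>\<xi>. (A \<xi> * of_real (gauss (r *\<^sub>R (\<xi> - p)))) \<partial>lborel)"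
      by (rule integral_mult_right_zero)
    also have "\<dots> = of_real c * (\<integral>z. A (p + (1/r) *\<^sub>R z) * of_real (gauss z) \<partial>lborel)"
      using r by (subst integral_lborel_affine[where c="1/r" and t=p])
       (auto simp: scaleR_conv_of_real power_one_over field_simps)
    finally show ?thesis .
  qed
  have "(\<lambda>n. \<integral>z. A (p + (1/real (Suc n)) *\<^sub>R z) * of_real (gauss z) \<partial>lborel)
     \<longlonglongrightarrow> (\<integral>z. A p * of_real (gauss (z::'a)) \<partial>lborel)"
  proof (rule integral_dominated_convergence[where w="\<lambda>z. B * gauss z"])
    show "integrable lborel (\<lambda>z::'a. B * gauss z)" by (intro integrable_mult_right gauss_integrable)
    show "AE z in lborel. (\<lambda>n. A (p + (1/real (Suc n)) *\<^sub>R z) * of_real (gauss z)) \<longlonglongrightarrow> A p * of_real (gauss z)"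
    proof (rule AE_I2)
      fix z :: 'a
      have "(\<lambda>n. p + (1/real (Suc n)) *\<^sub>R z) \<longlonglongrightarrow> p + 0 *\<^sub>R z"
        by (intro tendsto_intros LIMSEQ_Suc[OF lim_1_over_n])
      then have "(\<lambda>n. A (p + (1/real (Suc n)) *\<^sub>R z)) \<longlonglongrightarrow> A p"
        using isCont_tendsto_compose[OF cont] by simp
      then show "(\<lambda>n. A (p + (1/real (Suc n)) *\<^sub>R z) * of_real (gauss z)) \<longlonglongrightarrow> A p * of_real (gauss z)"
        by (intro tendsto_intros)
    qed
    show "\<And>n. AE z in lborel. norm (A (p + (1/real (Suc n)) *\<^sub>R z) * of_real (gauss z)) \<le> B * gauss z"
      using B by (auto simp: norm_mult gauss_def)
  qed measurable
  then have "(\<lambda>n. of_real c * (\<integral>z. A (p + (1/real (Suc n)) *\<^sub>R z) * of_real (gauss z) \<partial>lborel))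
     \<longlonglongrightarrow> of_real c * (\<integral>z. A p * of_real (gauss (z::'a)) \<partial>lborel)"
    by (intro tendsto_intros)
  moreover have "of_real c * (\<integral>z. A p * of_real (gauss (z::'a)) \<partial>lborel) = (2*pi) ^ DIM('a) * A p"
  proof -
    have "(\<integral>z. A p * of_real (gauss (z::'a)) \<partial>lborel) = A p * of_real c"
      unfolding integral_mult_right_zero integral_complex_of_real gauss_integral c_def ..
    moreover have "c * c = (2*pi) ^ DIM('a)"
      unfolding c_def power_mult_distrib[symmetric] by simp
    moreover have "of_real c * (A p * of_real c) = complex_of_real (c * c) * A p"
      by simp
    ultimately show ?thesis
      by (simp only: of_real_power of_real_mult of_real_numeral)
  qed
  ultimately show ?thesis
    by (simp only: eq of_nat_0_less_iff zero_less_Suc)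
qed

section \<open>Bounded functions of bounded support and their convolutions\<close>

text \<open>This class is small enough that all transforms are absolutely convergent integrals and large enough
  for every purpose here: it is dense in \<open>L\<^sup>2\<close>, closed under convolution, and contains indicator functions of
  bounded Borel sets, so no continuity has to be carried along.\<close>

definition Linf_c :: "('a::euclidean_space \<Rightarrow> complex) set" where
  "Linf_c = {h \<in> borel_measurable borel. bounded (range h) \<and> bounded {x. h x \<noteq> 0}}"

lemma Linf_c_measurable: "h \<in> Linf_c \<Longrightarrow> h \<in> borel_measurable borel"
  by (simp add: Linf_c_def)

lemma Linf_cI:
  assumes "h \<in> borel_measurable borel" "\<And>x. cmod (h x) \<le> M" "\<And>x. norm x > R \<Longrightarrow> h x = 0"
  shows "h \<in> Linf_c"
  unfolding Linf_c_def
proof (intro CollectI conjI)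
  show "bounded (range h)" using assms(2) by (auto simp: bounded_iff)
  show "bounded {x. h x \<noteq> 0}" using assms(3) unfolding bounded_iff by (metis mem_Collect_eq not_le)
qed (fact assms(1))

lemma Linf_cE:
  assumes "h \<in> Linf_c"
  obtains M R where "M > 0" "R > 0" "\<And>x. cmod (h x) \<le> M" "\<And>x. norm x > R \<Longrightarrow> h x = 0"
proof -
  from assms have "bounded (range h)" "bounded {x. h x \<noteq> 0}" by (auto simp: Linf_c_def)
  then obtain M R where "M > 0" "\<forall>w\<in>range h. norm w \<le> M" "R > 0" "\<forall>x\<in>{x. h x \<noteq> 0}. norm x \<le> R"
    unfolding bounded_pos by auto
  then show ?thesis using that[of M R] by force
qed

lemma integrable_indicator_cball:
  "integrable lborel (indicator (cball (a::'a::euclidean_space) r) :: 'a \<Rightarrow> real)"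
  using emeasure_bounded_finite[OF bounded_cball, of a r] by (intro integrable_real_indicator) auto

lemma Linf_c_integrable: 
  assumes "h \<in> Linf_c" shows "integrable lborel h"
proof -
  obtain M R where *: "M > 0" "R > 0" "\<And>x. cmod (h x) \<le> M" "\<And>x. norm x > R \<Longrightarrow> h x = 0"
    by (rule Linf_cE[OF assms]) blast
  have "integrable lborel (\<lambda>x. M * indicator (cball 0 R) x)"
    by (intro integrable_mult_right integrable_indicator_cball)
  then show ?thesis
  proof (rule Bochner_Integration.integrable_bound)
    show "h \<in> borel_measurable lborel"
      using Linf_c_measurable[OF assms] by simp
    show "AE x in lborel. norm (h x) \<le> norm (M * indicator (cball 0 R) x)"
    proof (rule AE_I2)
      fix x
      show "norm (h x) \<le> norm (M * indicator (cball 0 R) x)"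
        using * by (cases "norm x > R") (auto simp: indicator_def)
    qed
  qed
qed

lemma Linf_c_mult:
  assumes h: "h \<in> Linf_c" and [measurable]: "w \<in> borel_measurable borel" and w: "\<And>x. cmod (w x) \<le> B"
  shows "(\<lambda>x. h x * w x) \<in> Linf_c"
proof -
  note Linf_c_measurable[OF h, measurable]
  obtain M R where *: "M > 0" "R > 0" "\<And>x. cmod (h x) \<le> M" "\<And>x. norm x > R \<Longrightarrow> h x = 0"
    by (rule Linf_cE[OF h]) blast
  show ?thesis
    by (rule Linf_cI[of _ "M * B" R]) (use * w in \<open>auto simp: norm_mult intro!: mult_mono order.trans[OF norm_ge_zero w]\<close>)
qed

lemma Linf_c_cmult: "h \<in> Linf_c \<Longrightarrow> (\<lambda>x. c * h x) \<in> Linf_c"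
  using Linf_c_mult[of h "\<lambda>_. c" "cmod c"] by (simp add: mult.commute)

lemma Linf_c_diff:
  assumes h: "h \<in> Linf_c" and k: "k \<in> Linf_c"
  shows "(\<lambda>x. h x - k x) \<in> Linf_c"
proof -
  note Linf_c_measurable[OF h, measurable] Linf_c_measurable[OF k, measurable]
  obtain M R where 1: "M > 0" "R > 0" "\<And>x. cmod (h x) \<le> M" "\<And>x. norm x > R \<Longrightarrow> h x = 0"
    by (rule Linf_cE[OF h]) blast
  obtain N S where 2: "N > 0" "S > 0" "\<And>x. cmod (k x) \<le> N" "\<And>x. norm x > S \<Longrightarrow> k x = 0"
    by (rule Linf_cE[OF k]) blast
  show ?thesis
    by (rule Linf_cI[of _ "M + N" "max R S"]) (use 1 2 in \<open>auto intro!: order.trans[OF norm_triangle_ineq4] add_mono\<close>)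
qed

lemma cnj_measurable [measurable]: "cnj \<in> borel_measurable borel"
  by (intro borel_measurable_continuous_onI continuous_intros)

lemma Linf_c_cnj: 
  assumes h: "h \<in> Linf_c" shows "(\<lambda>x. cnj (h x)) \<in> Linf_c"
proof -
  note Linf_c_measurable[OF h, measurable]
  obtain M R where "M > 0" "R > 0" "\<And>x. cmod (h x) \<le> M" "\<And>x. norm x > R \<Longrightarrow> h x = 0"
    by (rule Linf_cE[OF h]) blast
  then show ?thesis by (intro Linf_cI[of _ M R]) auto
qed

lemma Linf_c_affine:
  assumes h: "h \<in> Linf_c" and c: "c \<noteq> 0" shows "(\<lambda>x. h (t + c *\<^sub>R x)) \<in> Linf_c"
proof -
  note Linf_c_measurable[OF h, measurable]
  obtain M R where *: "M > 0" "R > 0" "\<And>x. cmod (h x) \<le> M" "\<And>x. norm x > R \<Longrightarrow> h x = 0"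
    by (rule Linf_cE[OF h]) blast
  have "norm (t + c *\<^sub>R x) > R" if "norm x > (R + norm t) / \<bar>c\<bar>" for x
  proof -
    have "R + norm t < norm (c *\<^sub>R x)" using that c by (simp add: field_simps)
    also have "\<dots> \<le> norm (t + c *\<^sub>R x) + norm t" by (metis add_diff_cancel_left' norm_triangle_ineq4)
    finally show ?thesis by simp
  qed
  with * show ?thesis by (intro Linf_cI[of _ M "(R + norm t) / \<bar>c\<bar>"]) auto
qed

lemma Linf_c_scale: "h \<in> Linf_c \<Longrightarrow> c \<noteq> 0 \<Longrightarrow> (\<lambda>x. h (c *\<^sub>R x)) \<in> Linf_c"
  using Linf_c_affine[of h c 0] by simp

lemma ft_bounded:
  assumes "h \<in> Linf_c" shows "cmod (ft h x) \<le> (\<integral>\<xi>. cmod (h \<xi>) \<partial>lborel)"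
proof -
  have "cmod (ft h x) \<le> (\<integral>\<xi>. cmod (h \<xi> * cis (x \<bullet> \<xi>)) \<partial>lborel)"
    unfolding ft_def by (rule integral_norm_bound)
  then show ?thesis by (simp add: norm_mult)
qed

definition conv :: "('a::euclidean_space \<Rightarrow> complex) \<Rightarrow> ('a \<Rightarrow> complex) \<Rightarrow> 'a \<Rightarrow> complex" where
  "conv h k x = (\<integral>y. h (x - y) * k y \<partial>lborel)"

text \<open>This provides the integrability that Fubini needs for convolutions.\<close>

lemma Linf_c_conv_pair:
  assumes h: "h \<in> Linf_c" and k: "k \<in> Linf_c"
  shows "(\<lambda>(x, y). h (x - y) * k y) \<in> Linf_c"
proof -
  note Linf_c_measurable[OF h, measurable] Linf_c_measurable[OF k, measurable]
  obtain M R where 1: "M > 0" "R > 0" "\<And>x. cmod (h x) \<le> M" "\<And>x. norm x > R \<Longrightarrow> h x = 0"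
    by (rule Linf_cE[OF h]) blast
  obtain N S where 2: "N > 0" "S > 0" "\<And>x. cmod (k x) \<le> N" "\<And>x. norm x > S \<Longrightarrow> k x = 0"
    by (rule Linf_cE[OF k]) blast
  show ?thesis
  proof (rule Linf_cI[of _ "M * N" "R + 2 * S"])
    show "(\<lambda>(x, y). h (x - y) * k y) \<in> borel_measurable borel"
      unfolding borel_prod[symmetric] by measurable
    show "cmod (case p of (x, y) \<Rightarrow> h (x - y) * k y) \<le> M * N" for p
      using 1 2 by (auto simp: norm_mult split_beta intro!: mult_mono)
    show "(case p of (x, y) \<Rightarrow> h (x - y) * k y) = 0" if "norm p > R + 2 * S" for p
    proof -
      obtain x y where p: "p = (x, y)" by force
      have "norm p \<le> norm x + norm y" unfolding p by (rule norm_Pair_le)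
      also have "norm x \<le> norm (x - y) + norm y" by (metis diff_add_cancel norm_triangle_ineq)
      finally have "norm (x - y) > R \<or> norm y > S" using that by linarith
      then show ?thesis using 1 2 p by auto
    qed
  qed
qed

lemma Linf_c_conv:
  assumes h: "h \<in> Linf_c" and k: "k \<in> Linf_c"
  shows "conv h k \<in> Linf_c"
proof -
  note Linf_c_measurable[OF h, measurable] Linf_c_measurable[OF k, measurable]
  obtain M R where 1: "M > 0" "R > 0" "\<And>x. cmod (h x) \<le> M" "\<And>x. norm x > R \<Longrightarrow> h x = 0"
    by (rule Linf_cE[OF h]) blast
  obtain N S where 2: "N > 0" "S > 0" "\<And>x. cmod (k x) \<le> N" "\<And>x. norm x > S \<Longrightarrow> k x = 0"
    by (rule Linf_cE[OF k]) blast
  show ?thesis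
  proof (rule Linf_cI[of _ "M * (\<integral>y. cmod (k y) \<partial>lborel)" "R + S"])
    show "conv h k \<in> borel_measurable borel" unfolding conv_def by measurable
    fix x
    have "cmod (conv h k x) \<le> (\<integral>y. cmod (h (x - y) * k y) \<partial>lborel)"
      unfolding conv_def by (rule integral_norm_bound)
    also have "\<dots> \<le> (\<integral>y. M * cmod (k y) \<partial>lborel)"
      using 1 k Linf_c_integrable[OF k]
      by (intro integral_mono') (auto simp: norm_mult intro!: mult_right_mono)
    finally show "cmod (conv h k x) \<le> M * (\<integral>y. cmod (k y) \<partial>lborel)" by simp
    assume x: "norm x > R + S"
    have z: "h (x - y) * k y = 0" for y
    proof -
      have "norm x \<le> norm (x - y) + norm y" by (metis diff_add_cancel norm_triangle_ineq)
      then have "norm (x - y) > R \<or> norm y > S" using x by linarith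
      then show ?thesis using 1 2 by auto
    qed
    show "conv h k x = 0" unfolding conv_def z by simp
  qed
qed

lemma ft_conv:
  assumes h: "h \<in> Linf_c" and k: "k \<in> Linf_c"
  shows "ft (conv h k) x = ft h x * ft k x"
proof -
  have i: "integrable (lborel \<Otimes>\<^sub>M lborel) (\<lambda>(\<xi>, y). h (\<xi> - y) * k y * cis (x \<bullet> \<xi>))"
    unfolding lborel_prod using integrable_mult_cis[OF Linf_c_integrable[OF Linf_c_conv_pair[OF h k]], of "\<lambda>p. x \<bullet> fst p"]
    by (simp add: split_beta' borel_measurable_continuous_onI continuous_intros)
  have "ft (conv h k) x = (\<integral>\<xi>. (\<integral>y. h (\<xi> - y) * k y * cis (x \<bullet> \<xi>) \<partial>lborel) \<partial>lborel)"
    unfolding ft_def conv_def by simp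
  also have "\<dots> = (\<integral>y. (\<integral>\<xi>. h (\<xi> - y) * k y * cis (x \<bullet> \<xi>) \<partial>lborel) \<partial>lborel)"
    by (rule lborel_pair.Fubini_integral[symmetric]) (use i in simp)
  also have "\<dots> = (\<integral>y. ft h x * (k y * cis (x \<bullet> y)) \<partial>lborel)"
  proof (intro Bochner_Integration.integral_cong refl)
    fix y
    have "(\<integral>\<xi>. h (\<xi> - y) * k y * cis (x \<bullet> \<xi>) \<partial>lborel) = (\<integral>\<xi>. h \<xi> * k y * cis (x \<bullet> (y + \<xi>)) \<partial>lborel)"
      by (subst integral_lborel_affine[where c=1 and t=y]) simp_all
    also have "\<dots> = (\<integral>\<xi>. h \<xi> * cis (x \<bullet> \<xi>) * (k y * cis (x \<bullet> y)) \<partial>lborel)"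
      by (intro Bochner_Integration.integral_cong refl)
         (simp add: inner_add_right flip: cis_mult)
    also have "\<dots> = ft h x * (k y * cis (x \<bullet> y))"
      unfolding ft_def by (rule integral_mult_left_zero)
    finally show "(\<integral>\<xi>. h (\<xi> - y) * k y * cis (x \<bullet> \<xi>) \<partial>lborel) = \<dots>" .
  qed
  also have "\<dots> = ft h x * ft k x"
    unfolding ft_def by simp
  finally show ?thesis .
qed

text \<open>A measurable function is an almost everywhere limit of continuous ones. Projecting the approximants to
  the disc that contains the values of \<open>h\<close>, and cutting them off outside a ball, turns this into
  dominated convergence.\<close>

lemma Linf_c_approx_continuous:
  fixes h :: "'a::euclidean_space \<Rightarrow> complex"
  assumes h: "h \<in> Linf_c"
  obtains g where "\<And>n. g n \<in> Linf_c" "\<And>n. continuous_on UNIV (g n)"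
    "(\<lambda>n. \<integral>x. cmod (g n x - h x) \<partial>lborel) \<longlonglongrightarrow> 0"
proof -
  note Linf_c_measurable[OF h, measurable]
  obtain M R where hM: "M > 0" "R > 0" "\<And>x. cmod (h x) \<le> M" "\<And>x. norm x > R \<Longrightarrow> h x = 0"
    by (rule Linf_cE[OF h]) blast
  have "h measurable_on UNIV"
    by (intro lebesgue_measurable_imp_measurable_on measurable_completion) auto
  then obtain N G where N: "negligible N" and G: "\<And>n::nat. continuous_on UNIV (G n)"
    and lim: "\<And>x. x \<notin> N \<Longrightarrow> (\<lambda>n. G n x) \<longlonglongrightarrow> h x"
    unfolding measurable_on_def by auto
  define T where "T = closest_point (cball (0::complex) M)"
  have T_cont: "continuous_on UNIV T"
    unfolding T_def using hM by (intro continuous_on_closest_point) auto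
  have T_norm: "cmod (T w) \<le> M" for w
    using closest_point_in_set[of "cball (0::complex) M" w] hM by (simp add: T_def)
  have T_self: "T w = w" if "cmod w \<le> M" for w
    using that by (simp add: T_def closest_point_self)
  define cut where "cut x = max 0 (min 1 (R + 1 - norm x))" for x :: 'a
  define g where "g n x = of_real (cut x) * T (G n x)" for n x
  have g_norm: "cmod (g n x) \<le> M" for n x
  proof -
    have "\<bar>cut x\<bar> * cmod (T (G n x)) \<le> 1 * M"
      by (rule mult_mono) (auto simp: cut_def T_norm)
    then show ?thesis by (simp add: g_def norm_mult)
  qed
  have g_supp: "g n x = 0" if "norm x > R + 1" for n x
    using that by (simp add: g_def cut_def)
  have g_cont: "continuous_on UNIV (g n)" for n
  proof -
    have "continuous_on UNIV (\<lambda>x. T (G n x))"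
      using continuous_on_compose2[OF T_cont G] by simp
    then show ?thesis
      unfolding g_def cut_def by (intro continuous_intros)
  qed
  have g: "g n \<in> Linf_c" for n
    by (rule Linf_cI[OF borel_measurable_continuous_onI[OF g_cont] g_norm g_supp])
  note Linf_c_measurable[OF g, measurable]
  have "AE x in lborel. x \<notin> N"
  proof -
    have "N \<in> null_sets lebesgue" using N negligible_iff_null_sets by blast
    then show ?thesis using AE_not_in AE_completion_iff by blast
  qed
  then have "AE x in lborel. (\<lambda>n. cmod (g n x - h x)) \<longlonglongrightarrow> 0"
  proof eventually_elim
    case (elim x)
    have "isCont T (h x)" using T_cont by (simp add: continuous_on_eq_continuous_at)
    from isCont_tendsto_compose[OF this lim[OF elim]] have "(\<lambda>n. T (G n x)) \<longlonglongrightarrow> h x"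
      using T_self hM by auto
    then have "(\<lambda>n. cmod (g n x - h x)) \<longlonglongrightarrow> cmod (of_real (cut x) * h x - h x)"
      unfolding g_def by (intro tendsto_intros)
    moreover have "of_real (cut x) * h x - h x = 0"
      using hM(4)[of x] by (cases "norm x > R") (auto simp: cut_def)
    ultimately show ?case by simp
  qed
  moreover have "AE x in lborel. norm (cmod (g n x - h x)) \<le> 2 * M * indicator (cball 0 (R + 1)) x" for n
  proof (rule AE_I2)
    fix x
    have "cmod (g n x - h x) \<le> M + M"
      by (rule order.trans[OF norm_triangle_ineq4 add_mono[OF g_norm hM(3)]])
    then show "norm (cmod (g n x - h x)) \<le> 2 * M * indicator (cball 0 (R + 1)) x"
      using g_supp[of x n] hM(4)[of x] by (cases "norm x > R + 1") (auto simp: indicator_def)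
  qed
  ultimately have "(\<lambda>n. \<integral>x. cmod (g n x - h x) \<partial>lborel) \<longlonglongrightarrow> (\<integral>x. 0 \<partial>(lborel :: 'a measure))"
    by (intro integral_dominated_convergence[where w="\<lambda>x. 2 * M * indicator (cball 0 (R + 1)) x"])
       (auto intro!: integrable_mult_right integrable_indicator_cball)
  then show ?thesis using that[OF g g_cont] by simp
qed

text \<open>Continuity is clear when \<open>h\<close> is continuous, and it survives the passage to \<open>L\<^sup>1\<close> limits in \<open>h\<close> because
  \<open>k\<close> is bounded, which makes the convolutions converge uniformly.\<close>

lemma conv_continuous:
  fixes h :: "'a::euclidean_space \<Rightarrow> complex"
  assumes h: "h \<in> Linf_c" and k: "k \<in> Linf_c"
  shows "continuous_on UNIV (conv h k)"
proof -
  note Linf_c_measurable[OF h, measurable] Linf_c_measurable[OF k, measurable]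
  obtain N S where kN: "N > 0" "S > 0" "\<And>x. cmod (k x) \<le> N" "\<And>x. norm x > S \<Longrightarrow> k x = 0"
    by (rule Linf_cE[OF k]) blast
  obtain g where g: "\<And>n. g n \<in> Linf_c" and g_cont: "\<And>n::nat. continuous_on UNIV (g n)"
    and lim: "(\<lambda>n. \<integral>x. cmod (g n x - h x) \<partial>lborel) \<longlonglongrightarrow> 0"
    by (rule Linf_c_approx_continuous[OF h]) (rule that)
  note Linf_c_measurable[OF g, measurable]
  have cont: "continuous_on UNIV (conv (g n) k)" for n
    unfolding continuous_on_sequentially
  proof (intro allI ballI impI, elim conjE)
    obtain M R where gM: "M > 0" "R > 0" "\<And>x. cmod (g n x) \<le> M" "\<And>x. norm x > R \<Longrightarrow> g n x = 0"
      by (rule Linf_cE[OF g]) blast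
    fix x and a :: 'a assume x: "x \<longlonglongrightarrow> a"
    show "(conv (g n) k \<circ> x) \<longlonglongrightarrow> conv (g n) k a"
      unfolding conv_def o_def
    proof (rule integral_dominated_convergence[where w="\<lambda>y. M * cmod (k y)"])
      show "AE y in lborel. (\<lambda>i. g n (x i - y) * k y) \<longlonglongrightarrow> g n (a - y) * k y"
        using g_cont[of n] x
        by (intro AE_I2 tendsto_intros isCont_tendsto_compose[of _ "g n"])
           (auto simp: continuous_on_eq_continuous_at)
      show "integrable lborel (\<lambda>y. M * cmod (k y))"
        using Linf_c_integrable[OF k] by auto
      show "AE y in lborel. norm (g n (x i - y) * k y) \<le> M * cmod (k y)" for i
        using gM by (auto simp: norm_mult intro!: mult_right_mono)
    qed measurable
  qed
  have bound: "dist (conv (g n) k x) (conv h k x) \<le> N * (\<integral>x. cmod (g n x - h x) \<partial>lborel)" for n x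
  proof -
    have i: "integrable lborel (\<lambda>y. q (x - y) * k y)" if q: "q \<in> Linf_c" for q
    proof -
      have [measurable]: "q \<in> borel_measurable borel" by (rule Linf_c_measurable[OF q])
      obtain M R where "M > 0" "R > 0" "\<And>x. cmod (q x) \<le> M" "\<And>x. norm x > R \<Longrightarrow> q x = 0"
        by (rule Linf_cE[OF q]) blast
      then have "(\<lambda>y. k y * q (x - y)) \<in> Linf_c"
        by (intro Linf_c_mult[OF k, of _ M]) auto
      from Linf_c_integrable[OF this] show ?thesis by (simp add: mult.commute)
    qed
    have d: "integrable lborel (\<lambda>y. cmod (g n (x - y) - h (x - y)))"
      using integrable_lborel_affine_iff[of "-1" "\<lambda>y. cmod (g n y - h y)" x]
        Linf_c_integrable[OF Linf_c_diff[OF g h]] by simp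
    have "conv (g n) k x - conv h k x = (\<integral>y. (g n (x - y) - h (x - y)) * k y \<partial>lborel)"
      unfolding conv_def using i[OF g] i[OF h]
      by (subst Bochner_Integration.integral_diff[symmetric]) (auto simp: algebra_simps)
    also have "cmod \<dots> \<le> (\<integral>y. cmod ((g n (x - y) - h (x - y)) * k y) \<partial>lborel)"
      by (rule integral_norm_bound)
    also have "\<dots> \<le> (\<integral>y. N * cmod (g n (x - y) - h (x - y)) \<partial>lborel)"
      using kN d by (intro integral_mono') (auto simp: norm_mult mult.commute[of N] intro!: mult_left_mono)
    also have "\<dots> = N * (\<integral>y. cmod (g n (x - y) - h (x - y)) \<partial>lborel)"
      by simp
    also have "(\<integral>y. cmod (g n (x - y) - h (x - y)) \<partial>lborel) = (\<integral>y. cmod (g n y - h y) \<partial>lborel)"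
      by (subst (2) integral_lborel_affine[where c="-1" and t=x]) simp_all
    finally show ?thesis by (simp add: dist_norm)
  qed
  have "uniform_limit UNIV (\<lambda>n. conv (g n) k) (conv h k) sequentially"
  proof (rule uniform_limitI)
    fix e :: real assume "e > 0"
    have "(\<lambda>n. N * (\<integral>x. cmod (g n x - h x) \<partial>lborel)) \<longlonglongrightarrow> N * 0"
      using lim by (intro tendsto_intros)
    then have "\<forall>\<^sub>F n in sequentially. N * (\<integral>x. cmod (g n x - h x) \<partial>lborel) < e"
      using \<open>e > 0\<close> by (intro order_tendstoD(2)) auto
    then show "\<forall>\<^sub>F n in sequentially. \<forall>x\<in>UNIV. dist (conv (g n) k x) (conv h k x) < e"
      by eventually_elim (use bound le_less_trans in blast)
  qed
  then show ?thesis
    by (rule uniform_limit_theorem[rotated]) (use cont in auto)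
qed

section \<open>Parseval's identity and inversion at points of continuity\<close>

text \<open>The involution that the Fourier transform turns into complex conjugation.\<close>

definition adj :: "('a::euclidean_space \<Rightarrow> complex) \<Rightarrow> 'a \<Rightarrow> complex" where
  "adj h x = cnj (h (- x))"

lemma Linf_c_adj: "h \<in> Linf_c \<Longrightarrow> adj h \<in> Linf_c"
  using Linf_c_cnj[OF Linf_c_scale[of h "-1"]] by (simp add: adj_def[abs_def])

lemma ft_adj: "ft (adj h) x = cnj (ft h x)"
  unfolding ft_def adj_def
  by (subst integral_lborel_affine[where c="-1" and t=0])
     (simp_all add: cis_cnj flip: Bochner_Integration.integral_cnj)

lemma ft_mult_cnj:
  assumes "h \<in> Linf_c" "k \<in> Linf_c"
  shows "ft h x * cnj (ft k x) = ft (conv h (adj k)) x"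
  using assms by (simp add: ft_conv Linf_c_adj ft_adj)

lemma conv_adj_0: "conv h (adj k) 0 = (\<integral>\<xi>. h \<xi> * cnj (k \<xi>) \<partial>lborel)"
  unfolding conv_def adj_def
  by (subst (2) integral_lborel_affine[where c="-1" and t=0]) simp_all

lemma integrable_mult_cnj:
  fixes f g :: "'a \<Rightarrow> complex"
  assumes f: "integrable M (\<lambda>x. (cmod (f x))\<^sup>2)" "f \<in> borel_measurable M"
    and g: "integrable M (\<lambda>x. (cmod (g x))\<^sup>2)" "g \<in> borel_measurable M"
  shows "integrable M (\<lambda>x. f x * cnj (g x))"
proof (rule Bochner_Integration.integrable_bound)
  show "integrable M (\<lambda>x. (cmod (f x))\<^sup>2 + (cmod (g x))\<^sup>2)"
    using f g by simp
  have "(\<lambda>x. cnj (g x)) \<in> borel_measurable M"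
    using measurable_compose[OF g(2) cnj_measurable] .
  with f(2) show "(\<lambda>x. f x * cnj (g x)) \<in> borel_measurable M"
    by (rule borel_measurable_times)
  have "cmod (f x) * cmod (g x) \<le> (cmod (f x))\<^sup>2 + (cmod (g x))\<^sup>2" for x
    using sum_squares_bound[of "cmod (f x)" "cmod (g x)"] mult_nonneg_nonneg[OF norm_ge_zero norm_ge_zero, of "f x" "g x"]
    by linarith
  then show "AE x in M. norm (f x * cnj (g x)) \<le> norm ((cmod (f x))\<^sup>2 + (cmod (g x))\<^sup>2)"
    by (auto simp: norm_mult)
qed

lemma
  shows gauss_scaled_le: "gauss (x /\<^sub>R r) \<le> 1"
    and gauss_nonneg: "0 \<le> gauss y"
    and gauss_scaled_tendsto: "(\<lambda>n. gauss (x /\<^sub>R real (Suc n))) \<longlonglongrightarrow> 1"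
proof -
  show "gauss (x /\<^sub>R r) \<le> 1" "0 \<le> gauss y" by (auto simp: gauss_def)
  have "(\<lambda>n. exp (- (norm (inverse (real (Suc n)) *\<^sub>R x))\<^sup>2 / 2)) \<longlonglongrightarrow> exp (- (norm (0 *\<^sub>R x))\<^sup>2 / 2)"
    by (intro tendsto_intros LIMSEQ_inverse_real_of_nat) simp
  then show "(\<lambda>n. gauss (x /\<^sub>R real (Suc n))) \<longlonglongrightarrow> 1"
    by (simp add: gauss_def)
qed

lemma norm_mult_gauss_le: "norm (z * of_real (gauss (x /\<^sub>R r)) :: complex) \<le> norm z"
  using gauss_scaled_le[of r x] gauss_nonneg[of "x /\<^sub>R r"] by (simp add: norm_mult mult_left_le)

text \<open>\<open>ft h x * cnj (ft k x)\<close> is the transform of a convolution whose value at the origin is the inner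
  product of \<open>h\<close> and \<open>k\<close>.\<close>

lemma gauss_mean_ft_mult_cnj:
  fixes h k :: "'a::euclidean_space \<Rightarrow> complex"
  assumes h: "h \<in> Linf_c" and k: "k \<in> Linf_c"
  shows "(\<lambda>n. \<integral>x. ft h x * cnj (ft k x) * of_real (gauss (x /\<^sub>R real (Suc n))) \<partial>lborel)
    \<longlonglongrightarrow> (2*pi) ^ DIM('a) * (\<integral>\<xi>. h \<xi> * cnj (k \<xi>) \<partial>lborel)"
proof -
  have A: "conv h (adj k) \<in> Linf_c" using h k by (intro Linf_c_conv Linf_c_adj)
  obtain M R where M: "\<And>x. cmod (conv h (adj k) x) \<le> M"
    by (rule Linf_cE[OF A]) blast
  have "isCont (conv h (adj k)) 0"
    using conv_continuous[OF h Linf_c_adj[OF k]] by (simp add: continuous_on_eq_continuous_at)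
  from gauss_summability[OF Linf_c_integrable[OF A] M this]
  show ?thesis by (simp add: conv_adj_0 ft_mult_cnj[OF h k])
qed

text \<open>For \<open>h = k\<close> the integrands of the Gaussian means are nonnegative, so that Fatou's lemma applies
  before anything is known about integrability.\<close>

lemma ft_square_integrable:
  fixes h :: "'a::euclidean_space \<Rightarrow> complex"
  assumes h: "h \<in> Linf_c"
  shows "integrable lborel (\<lambda>x. (cmod (ft h x))\<^sup>2)"
proof -
  note Linf_c_measurable[OF h, measurable]
  define G where "G n x = gauss (x /\<^sub>R real (Suc n))" for n and x :: 'a
  have [measurable]: "G n \<in> borel_measurable borel" for n unfolding G_def by measurable
  have G: "0 \<le> G n x" "G n x \<le> 1" "(\<lambda>n. G n x) \<longlonglongrightarrow> 1" for n x
    unfolding G_def by (rule gauss_nonneg gauss_scaled_le gauss_scaled_tendsto)+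
  have Gi: "integrable lborel (G n)" for n
    unfolding G_def using integrable_lborel_affine_iff[of "inverse (real (Suc n))" gauss "0::'a"] gauss_integrable
    by simp
  define B where "B = (\<integral>\<xi>. cmod (h \<xi>) \<partial>lborel)"
  have int: "integrable lborel (\<lambda>x. (cmod (ft h x))\<^sup>2 * G n x)" for n
  proof (rule Bochner_Integration.integrable_bound)
    show "integrable lborel (\<lambda>x. B\<^sup>2 * G n x)" by (intro integrable_mult_right Gi)
    show "AE x in lborel. norm ((cmod (ft h x))\<^sup>2 * G n x) \<le> norm (B\<^sup>2 * G n x)"
      using ft_bounded[OF h] G by (auto simp: B_def abs_mult intro!: mult_right_mono power_mono)
  qed measurable
  have "(\<lambda>n. \<integral>x. ft h x * cnj (ft h x) * of_real (G n x) \<partial>lborel)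
    \<longlonglongrightarrow> (2*pi) ^ DIM('a) * (\<integral>\<xi>. h \<xi> * cnj (h \<xi>) \<partial>lborel)"
    unfolding G_def by (rule gauss_mean_ft_mult_cnj[OF h h])
  from tendsto_Re[OF this] 
  obtain c where c: "(\<lambda>n. \<integral>x. (cmod (ft h x))\<^sup>2 * G n x \<partial>lborel) \<longlonglongrightarrow> c"
    unfolding complex_norm_square[symmetric] of_real_mult[symmetric] integral_complex_of_real by auto
  have "(\<integral>\<^sup>+x. ennreal ((cmod (ft h x))\<^sup>2) \<partial>lborel) 
    = (\<integral>\<^sup>+x. liminf (\<lambda>n. ennreal ((cmod (ft h x))\<^sup>2 * G n x)) \<partial>lborel)"
  proof (intro nn_integral_cong)
    fix x
    have "(\<lambda>n. ennreal ((cmod (ft h x))\<^sup>2 * G n x)) \<longlonglongrightarrow> ennreal ((cmod (ft h x))\<^sup>2 * 1)"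
      by (intro tendsto_ennrealI tendsto_intros G)
    then show "ennreal ((cmod (ft h x))\<^sup>2) = liminf (\<lambda>n. ennreal ((cmod (ft h x))\<^sup>2 * G n x))"
      by (simp add: lim_imp_Liminf)
  qed
  also have "\<dots> \<le> liminf (\<lambda>n. \<integral>\<^sup>+x. ennreal ((cmod (ft h x))\<^sup>2 * G n x) \<partial>lborel)"
    by (rule nn_integral_liminf) measurable
  also have "\<dots> = liminf (\<lambda>n. ennreal (\<integral>x. (cmod (ft h x))\<^sup>2 * G n x \<partial>lborel))"
    using int G by (subst nn_integral_eq_integral) auto
  also have "\<dots> = ennreal c"
    using c by (intro lim_imp_Liminf tendsto_ennrealI) auto
  finally show ?thesis
    by (intro integrableI_bounded) (auto simp: le_less_trans)
qed

theorem parseval: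
  fixes h k :: "'a::euclidean_space \<Rightarrow> complex"
  assumes h: "h \<in> Linf_c" and k: "k \<in> Linf_c"
  shows "integrable lborel (\<lambda>x. ft h x * cnj (ft k x))"
    and "(\<integral>x. ft h x * cnj (ft k x) \<partial>lborel) = (2*pi) ^ DIM('a) * (\<integral>\<xi>. h \<xi> * cnj (k \<xi>) \<partial>lborel)"
proof -
  note Linf_c_measurable[OF h, measurable] Linf_c_measurable[OF k, measurable]
  show int: "integrable lborel (\<lambda>x. ft h x * cnj (ft k x))"
    by (intro integrable_mult_cnj ft_square_integrable h k) measurable
  have "(\<lambda>n. \<integral>x. ft h x * cnj (ft k x) * of_real (gauss (x /\<^sub>R real (Suc n))) \<partial>lborel)
    \<longlonglongrightarrow> (\<integral>x. ft h x * cnj (ft k x) \<partial>lborel)"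
  proof (rule integral_dominated_convergence[where w="\<lambda>x. cmod (ft h x * cnj (ft k x))"])
    show "AE x in lborel. (\<lambda>n. ft h x * cnj (ft k x) * of_real (gauss (x /\<^sub>R real (Suc n)))) \<longlonglongrightarrow> ft h x * cnj (ft k x)"
    proof (rule AE_I2)
      fix x :: 'a
      have "(\<lambda>n. ft h x * cnj (ft k x) * of_real (gauss (x /\<^sub>R real (Suc n)))) \<longlonglongrightarrow> ft h x * cnj (ft k x) * of_real 1"
        by (intro tendsto_intros gauss_scaled_tendsto)
      then show "(\<lambda>n. ft h x * cnj (ft k x) * of_real (gauss (x /\<^sub>R real (Suc n)))) \<longlonglongrightarrow> ft h x * cnj (ft k x)" by simp
    qed
    show "AE x in lborel. norm (ft h x * cnj (ft k x) * of_real (gauss (x /\<^sub>R real (Suc n)))) \<le> cmod (ft h x * cnj (ft k x))" for n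
      by (intro AE_I2 norm_mult_gauss_le)
    show "integrable lborel (\<lambda>x. cmod (ft h x * cnj (ft k x)))"
      using int by (rule integrable_norm)
  qed measurable
  from LIMSEQ_unique[OF this gauss_mean_ft_mult_cnj[OF h k]]
  show "(\<integral>x. ft h x * cnj (ft k x) \<partial>lborel) = (2*pi) ^ DIM('a) * (\<integral>\<xi>. h \<xi> * cnj (k \<xi>) \<partial>lborel)" .
qed

lemma Linf_c_square_integrable:
  assumes "h \<in> Linf_c" shows "integrable lborel (\<lambda>x. (cmod (h x))\<^sup>2)"
proof -
  note Linf_c_measurable[OF assms, measurable]
  obtain M R where M: "\<And>x. cmod (h x) \<le> M"
    by (rule Linf_cE[OF assms]) blast
  have "(\<lambda>x. h x * cnj (h x)) \<in> Linf_c"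
    using M by (intro Linf_c_mult[OF assms, of _ M]) auto
  from Linf_c_integrable[OF this] show ?thesis
    unfolding complex_norm_square[symmetric] complex_of_real_integrable_eq .
qed

corollary plancherel:
  fixes h :: "'a::euclidean_space \<Rightarrow> complex"
  assumes h: "h \<in> Linf_c"
  shows "(\<integral>\<^sup>+x. ennreal ((cmod (ft h x))\<^sup>2) \<partial>lborel)
       = ennreal ((2*pi) ^ DIM('a)) * (\<integral>\<^sup>+\<xi>. ennreal ((cmod (h \<xi>))\<^sup>2) \<partial>lborel)"
proof -
  have "complex_of_real (\<integral>x. (cmod (ft h x))\<^sup>2 \<partial>lborel)
      = of_real ((2*pi) ^ DIM('a) * (\<integral>\<xi>. (cmod (h \<xi>))\<^sup>2 \<partial>lborel))"
    using parseval(2)[OF h h] unfolding complex_norm_square[symmetric] integral_complex_of_real by simp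
  then have "(\<integral>x. (cmod (ft h x))\<^sup>2 \<partial>lborel) = (2*pi) ^ DIM('a) * (\<integral>\<xi>. (cmod (h \<xi>))\<^sup>2 \<partial>lborel)"
    unfolding of_real_eq_iff .
  then show ?thesis
    using ft_square_integrable[OF h] Linf_c_square_integrable[OF h]
    by (simp add: nn_integral_eq_integral ennreal_mult)
qed

text \<open>When \<open>ft h\<close> is integrable, the Gaussian means also converge to the unweighted integral. The right-hand
  side is a continuous function of \<open>p\<close>, so \<open>h\<close> cannot have a jump.\<close>

lemma ft_inversion_at_continuity:
  fixes h :: "'a::euclidean_space \<Rightarrow> complex"
  assumes h: "h \<in> Linf_c" and int: "integrable lborel (ft h)" and cont: "isCont h p"
  shows "(2*pi) ^ DIM('a) * h p = ft (ft h) (- p)"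
proof -
  obtain M R where M: "\<And>x. cmod (h x) \<le> M" by (rule Linf_cE[OF h]) blast
  have "(\<lambda>n. \<integral>x. ft h x * cis (- (x \<bullet> p)) * of_real (gauss (x /\<^sub>R real (Suc n))) \<partial>lborel)
    \<longlonglongrightarrow> (\<integral>x. ft h x * cis (- p \<bullet> x) \<partial>lborel)"
  proof (rule integral_dominated_convergence[where w="\<lambda>x. cmod (ft h x)"])
    show "AE x in lborel. (\<lambda>n. ft h x * cis (- (x \<bullet> p)) * of_real (gauss (x /\<^sub>R real (Suc n)))) \<longlonglongrightarrow> ft h x * cis (- p \<bullet> x)"
    proof (rule AE_I2)
      fix x :: 'a
      have "(\<lambda>n. ft h x * cis (- (x \<bullet> p)) * of_real (gauss (x /\<^sub>R real (Suc n)))) \<longlonglongrightarrow> ft h x * cis (- (x \<bullet> p)) * of_real 1"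
        by (intro tendsto_intros gauss_scaled_tendsto)
      then show "(\<lambda>n. ft h x * cis (- (x \<bullet> p)) * of_real (gauss (x /\<^sub>R real (Suc n)))) \<longlonglongrightarrow> ft h x * cis (- p \<bullet> x)"
        by (simp add: inner_commute)
    qed
    show "AE x in lborel. norm (ft h x * cis (- (x \<bullet> p)) * of_real (gauss (x /\<^sub>R real (Suc n)))) \<le> cmod (ft h x)" for n
      using norm_mult_gauss_le[of "ft h x * cis (- (x \<bullet> p))" "real (Suc n)" x for x]
      by (intro AE_I2) (simp add: norm_mult)
    show "integrable lborel (\<lambda>x. cmod (ft h x))"
      using int by (rule integrable_norm)
  qed (use Linf_c_measurable[OF h] in measurable)
  from LIMSEQ_unique[OF this gauss_summability[OF Linf_c_integrable[OF h] M cont]]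
  show ?thesis unfolding ft_def[of "ft h"] by simp
qed

lemma ft_continuous:
  fixes h :: "'a::euclidean_space \<Rightarrow> complex"
  assumes h: "integrable lborel h"
  shows "continuous_on UNIV (ft h)"
  unfolding continuous_on_sequentially
proof (intro allI ballI impI, elim conjE)
  fix x and a :: 'a assume x: "x \<longlonglongrightarrow> a"
  have [measurable]: "h \<in> borel_measurable borel" using h by auto
  show "(ft h \<circ> x) \<longlonglongrightarrow> ft h a"
    unfolding ft_def o_def
  proof (rule integral_dominated_convergence[where w="\<lambda>\<xi>. cmod (h \<xi>)"])
    show "AE \<xi> in lborel. (\<lambda>i. h \<xi> * cis (x i \<bullet> \<xi>)) \<longlonglongrightarrow> h \<xi> * cis (a \<bullet> \<xi>)"
      using x by (intro AE_I2 tendsto_intros)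
  qed (use h in \<open>auto simp: norm_mult\<close>)
qed

section \<open>Isometric wavelet transforms\<close>

lemma ft_mult_formula:
  fixes \<phi> \<Theta> :: "'a::euclidean_space \<Rightarrow> complex"
  assumes \<phi>: "integrable lborel \<phi>" and \<Theta>: "integrable lborel \<Theta>"
  shows "(\<integral>y. \<phi> y * cnj (ft \<Theta> y) \<partial>lborel) = (\<integral>\<eta>. ft \<phi> (- \<eta>) * cnj (\<Theta> \<eta>) \<partial>lborel)"
proof -
  have [measurable]: "\<phi> \<in> borel_measurable borel" "\<Theta> \<in> borel_measurable borel" using \<phi> \<Theta> by auto
  have int: "integrable (lborel \<Otimes>\<^sub>M lborel) (\<lambda>(y, \<eta>). \<phi> y * cnj (\<Theta> \<eta>) * cis (- (y \<bullet> \<eta>)))"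
  proof (rule lborel_pair.Fubini_integrable)
    have "(\<lambda>y. LINT \<eta>|lborel. norm (case (y, \<eta>) of (y, \<eta>) \<Rightarrow> \<phi> y * cnj (\<Theta> \<eta>) * cis (- (y \<bullet> \<eta>))))
       = (\<lambda>y. norm (\<phi> y) * (LINT \<eta>|lborel. norm (\<Theta> \<eta>)))"
      by (simp add: norm_mult)
    with \<phi> show "integrable lborel (\<lambda>y. LINT \<eta>|lborel. norm (case (y, \<eta>) of (y, \<eta>) \<Rightarrow> \<phi> y * cnj (\<Theta> \<eta>) * cis (- (y \<bullet> \<eta>))))"
      by simp
    show "AE y in lborel. integrable lborel (\<lambda>\<eta>. case (y, \<eta>) of (y, \<eta>) \<Rightarrow> \<phi> y * cnj (\<Theta> \<eta>) * cis (- (y \<bullet> \<eta>)))"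
      using \<Theta> by (intro AE_I2) (auto intro!: integrable_mult_right integrable_mult_cis)
  qed measurable
  have "(\<integral>y. \<phi> y * cnj (ft \<Theta> y) \<partial>lborel) = (\<integral>y. (\<integral>\<eta>. \<phi> y * cnj (\<Theta> \<eta>) * cis (- (y \<bullet> \<eta>)) \<partial>lborel) \<partial>lborel)"
    unfolding ft_def by (simp add: cis_cnj mult.assoc flip: Bochner_Integration.integral_cnj)
  also have "\<dots> = (\<integral>\<eta>. (\<integral>y. \<phi> y * cnj (\<Theta> \<eta>) * cis (- (y \<bullet> \<eta>)) \<partial>lborel) \<partial>lborel)"
    by (rule lborel_pair.Fubini_integral[symmetric]) (use int in simp)
  also have "\<dots> = (\<integral>\<eta>. ft \<phi> (- \<eta>) * cnj (\<Theta> \<eta>) \<partial>lborel)"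
  proof (intro Bochner_Integration.integral_cong refl)
    fix \<eta>
    have "(\<integral>y. \<phi> y * cnj (\<Theta> \<eta>) * cis (- (y \<bullet> \<eta>)) \<partial>lborel) = (\<integral>y. (\<phi> y * cis (- \<eta> \<bullet> y)) * cnj (\<Theta> \<eta>) \<partial>lborel)"
      by (intro Bochner_Integration.integral_cong refl) (simp add: inner_commute)
    then show "(\<integral>y. \<phi> y * cnj (\<Theta> \<eta>) * cis (- (y \<bullet> \<eta>)) \<partial>lborel) = ft \<phi> (- \<eta>) * cnj (\<Theta> \<eta>)"
      unfolding ft_def by (simp only: integral_mult_left_zero)
  qed
  finally show ?thesis .
qed

lemma affG_borel [measurable]: "affG \<in> sets borel"
proof -
  have "affG = snd -` {0<..}" by (auto simp: affG_def)
  moreover have "open (snd -` {0::real<..} :: ((real^2) \<times> real) set)"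
    by (intro open_vimage open_greaterThan continuous_intros)
  ultimately show ?thesis by simp
qed

lemma space_haar [simp]: "space affG_haar = affG"
  by (simp add: affG_haar_def space_restrict_space)

lemma borel_measurable_haarI:
  "f \<in> borel_measurable borel \<Longrightarrow> f \<in> borel_measurable affG_haar"
  by (simp add: affG_haar_def measurable_restrict_space1)

text \<open>The inner integral runs over \<open>x\<close>, because for fixed \<open>s\<close> the wavelet transform is a Fourier
  transform in \<open>x\<close>.\<close>

lemma nn_integral_haar:
  fixes h :: "(real^2) \<times> real \<Rightarrow> ennreal"
  assumes [measurable]: "h \<in> borel_measurable borel"
  shows "(\<integral>\<^sup>+z. h z \<partial>affG_haar) = 
    (\<integral>\<^sup>+s. (\<integral>\<^sup>+x. h (x, s) \<partial>lborel) * (ennreal (1 / s^3) * indicator {0<..} s) \<partial>lborel)"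
proof -
  have [measurable]: "(\<lambda>(x, s). ennreal (1 / s^2 * (1 / s))) \<in> borel_measurable (borel :: ((real^2) \<times> real) measure)"
    unfolding borel_prod[symmetric] by measurable
  have h2: "(\<lambda>(x, s). h (x, s)) \<in> borel_measurable (borel \<Otimes>\<^sub>M borel)"
    unfolding borel_prod by simp
  have [measurable]: "Measurable.pred (borel \<Otimes>\<^sub>M borel) (\<lambda>p::(real^2) \<times> real. p \<in> affG)"
    unfolding borel_prod by measurable
  have "(\<integral>\<^sup>+z. h z \<partial>affG_haar) = (\<integral>\<^sup>+z. (case z of (x, s) \<Rightarrow> ennreal (1 / s^2 * (1 / s))) * h z \<partial>restrict_space lborel affG)"
    unfolding affG_haar_def by (intro nn_integral_density measurable_restrict_space1) measurable
  also have "\<dots> = (\<integral>\<^sup>+z. (case z of (x, s) \<Rightarrow> ennreal (1 / s^2 * (1 / s))) * h z * indicator affG z \<partial>lborel)"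
    by (subst nn_integral_restrict_space) auto
  also have "\<dots> = (\<integral>\<^sup>+z. (case z of (x, s) \<Rightarrow> h (x, s) * (ennreal (1 / s^3) * indicator {0<..} s)) \<partial>(lborel \<Otimes>\<^sub>M lborel))"
    unfolding lborel_prod
    by (intro nn_integral_cong) (auto simp: affG_def indicator_def mult.commute power2_eq_square power3_eq_cube)
  also have "\<dots> = (\<integral>\<^sup>+s. \<integral>\<^sup>+x. h (x, s) * (ennreal (1 / s^3) * indicator {0<..} s) \<partial>lborel \<partial>lborel)"
    using h2 by (subst lborel_pair.nn_integral_snd[symmetric]) simp_all
  also have "\<dots> = (\<integral>\<^sup>+s. (\<integral>\<^sup>+x. h (x, s) \<partial>lborel) * (ennreal (1 / s^3) * indicator {0<..} s) \<partial>lborel)"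
  proof (intro nn_integral_cong nn_integral_multc)
    fix s :: real
    show "(\<lambda>x. h (x, s)) \<in> borel_measurable lborel"
      using measurable_compose[OF measurable_Pair1' h2[simplified]] by simp
  qed
  finally show ?thesis .
qed

lemma quasi_regular_measurable [measurable]:
  assumes [measurable]: "\<psi> \<in> borel_measurable borel"
  shows "quasi_regular z \<psi> \<in> borel_measurable borel"
  unfolding quasi_regular_def[abs_def] by measurable

lemma wavelet_transform_measurable [measurable]:
  assumes [measurable]: "\<psi> \<in> borel_measurable borel" "\<phi> \<in> borel_measurable borel"
  shows "wavelet_transform \<psi> \<phi> \<in> borel_measurable borel"
  unfolding wavelet_transform_def[abs_def] L2_inner_def quasi_regular_def borel_prod[symmetric] by measurable

text \<open>The Fourier-side counterpart of \<open>quasi_regular z\<close>: a dilation followed by a modulation.\<close>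

definition dilmod :: "(real^2 \<Rightarrow> complex) \<Rightarrow> (real^2) \<times> real \<Rightarrow> real^2 \<Rightarrow> complex" where
  "dilmod \<Psi> z \<eta> = of_real (snd z) * \<Psi> (snd z *\<^sub>R \<eta>) * cis (- (fst z \<bullet> \<eta>))"

lemma Linf_c_dilmod:
  assumes \<Psi>: "\<Psi> \<in> Linf_c" and z: "z \<in> affG"
  shows "dilmod \<Psi> z \<in> Linf_c"
proof -
  have "snd z > 0" using z by (auto simp: affG_def)
  then have "(\<lambda>\<eta>. of_real (snd z) * \<Psi> (snd z *\<^sub>R \<eta>)) \<in> Linf_c"
    using \<Psi> by (intro Linf_c_cmult Linf_c_scale) auto
  from Linf_c_mult[OF this, of "\<lambda>\<eta>. cis (- (fst z \<bullet> \<eta>))" 1] show ?thesis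
    by (simp add: dilmod_def[abs_def])
qed

lemma quasi_regular_ft:
  assumes z: "z \<in> affG"
  shows "quasi_regular z (ft \<Psi>) = ft (dilmod \<Psi> z)"
proof
  fix y
  obtain x s where [simp]: "z = (x, s)" and s: "s > 0" using z by (auto simp: affG_def)
  have "ft \<Psi> ((1 / s) *\<^sub>R (y - x)) = s\<^sup>2 *\<^sub>R (\<integral>\<eta>. \<Psi> (s *\<^sub>R \<eta>) * cis ((y - x) \<bullet> \<eta>) \<partial>lborel)"
    unfolding ft_def using s by (subst integral_lborel_affine[where c=s and t=0]) simp_all
  then have "quasi_regular z (ft \<Psi>) y = of_real s * (\<integral>\<eta>. \<Psi> (s *\<^sub>R \<eta>) * cis ((y - x) \<bullet> \<eta>) \<partial>lborel)"
    using s by (simp add: quasi_regular_def scaleR_conv_of_real power2_eq_square)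
  also have "\<dots> = (\<integral>\<eta>. of_real s * (\<Psi> (s *\<^sub>R \<eta>) * cis ((y - x) \<bullet> \<eta>)) \<partial>lborel)"
    by (rule integral_mult_right_zero[symmetric])
  also have "\<dots> = ft (dilmod \<Psi> z) y"
    unfolding ft_def dilmod_def
    by (intro Bochner_Integration.integral_cong refl) (simp add: mult.assoc cis_mult inner_diff_left)
  finally show "quasi_regular z (ft \<Psi>) y = ft (dilmod \<Psi> z) y" .
qed

lemma integral_cnj_dilmod:
  "(\<integral>\<eta>. q \<eta> * cnj (dilmod \<Psi> (x, s) \<eta>) \<partial>lborel) = ft (\<lambda>\<eta>. of_real s * (q \<eta> * cnj (\<Psi> (s *\<^sub>R \<eta>)))) x"
  unfolding ft_def dilmod_def
  by (intro Bochner_Integration.integral_cong refl) (simp add: cis_cnj)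

text \<open>For \<open>\<psi>\<close> and \<open>\<phi>\<close> both given on the Fourier side, this is Parseval's identity.\<close>

lemma wavelet_transform_of_ft:
  assumes \<Psi>: "\<Psi> \<in> Linf_c" and \<Phi>: "\<Phi> \<in> Linf_c" and s: "s > 0"
  shows "wavelet_transform (ft \<Psi>) (ft \<Phi>) (x, s)
       = (2*pi)\<^sup>2 * ft (\<lambda>\<eta>. of_real s * (\<Phi> \<eta> * cnj (\<Psi> (s *\<^sub>R \<eta>)))) x"
proof -
  have z: "(x, s) \<in> affG" using s by (simp add: affG_def)
  show ?thesis
    unfolding wavelet_transform_def L2_inner_def quasi_regular_ft[OF z]
    using parseval(2)[OF \<Phi> Linf_c_dilmod[OF \<Psi> z]] by (simp add: integral_cnj_dilmod)
qed

text \<open>For \<open>\<phi>\<close> given on the space side, moving the transform from \<open>\<Psi>\<close> to \<open>\<phi>\<close> needs only Fubini. The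
  function \<open>\<eta> \<mapsto> ft \<phi> (- \<eta>)\<close> is bounded but need not have bounded support.\<close>

lemma wavelet_transform_of_Linf_c:
  assumes \<Psi>: "\<Psi> \<in> Linf_c" and \<phi>: "\<phi> \<in> Linf_c" and s: "s > 0"
  shows "wavelet_transform (ft \<Psi>) \<phi> (x, s)
       = ft (\<lambda>\<eta>. of_real s * (ft \<phi> (- \<eta>) * cnj (\<Psi> (s *\<^sub>R \<eta>)))) x"
proof -
  have z: "(x, s) \<in> affG" using s by (simp add: affG_def)
  show ?thesis
    unfolding wavelet_transform_def L2_inner_def quasi_regular_ft[OF z]
    using ft_mult_formula[OF Linf_c_integrable[OF \<phi>] Linf_c_integrable[OF Linf_c_dilmod[OF \<Psi> z]]]
    by (simp add: integral_cnj_dilmod)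
qed

text \<open>The Calderon condition. The constant is the one that makes the transform isometric: Plancherel is used
  twice, and each use costs a factor \<open>(2\<pi>)\<^sup>2\<close>.\<close>

definition admissible :: "(real^2 \<Rightarrow> complex) \<Rightarrow> bool" where
  "admissible \<Psi> \<longleftrightarrow> (\<forall>\<eta>. \<eta> \<noteq> 0 \<longrightarrow>
     (\<integral>\<^sup>+s. ennreal ((cmod (\<Psi> (s *\<^sub>R \<eta>)))\<^sup>2 / s) * indicator {0<..} s \<partial>lborel) = ennreal (1 / (2*pi)^4))"

text \<open>Plancherel in \<open>x\<close> for each \<open>s\<close>, Tonelli, the Calderon condition for each \<open>\<eta>\<close>, and Plancherel
  for \<open>\<phi>\<close>.\<close>

lemma wavelet_isometric_on_Linf_c:
  assumes \<Psi>: "\<Psi> \<in> Linf_c" and adm: "admissible \<Psi>" and \<phi>: "\<phi> \<in> Linf_c"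
  shows "(\<integral>\<^sup>+z. ennreal ((cmod (wavelet_transform (ft \<Psi>) \<phi> z))\<^sup>2) \<partial>affG_haar)
     = (\<integral>\<^sup>+x. ennreal ((cmod (\<phi> x))\<^sup>2) \<partial>lborel)"
proof -
  note Linf_c_measurable[OF \<Psi>, measurable] Linf_c_measurable[OF \<phi>, measurable]
  define u where "u \<eta> = (cmod (ft \<phi> (- \<eta>)))\<^sup>2" for \<eta>
  have [measurable]: "u \<in> borel_measurable borel" unfolding u_def by measurable
  define H where "H s = (\<lambda>\<eta>. of_real s * (ft \<phi> (- \<eta>) * cnj (\<Psi> (s *\<^sub>R \<eta>))))" for s :: real
  have H: "H s \<in> Linf_c" if "s > 0" for s
  proof -
    have "(\<lambda>\<eta>. cnj (\<Psi> (s *\<^sub>R \<eta>)) * (of_real s * ft \<phi> (- \<eta>))) \<in> Linf_c"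
      using that ft_bounded[OF \<phi>] \<Psi>
      by (intro Linf_c_mult[where B="s * (\<integral>\<xi>. cmod (\<phi> \<xi>) \<partial>lborel)"] Linf_c_cnj Linf_c_scale)
         (auto simp: norm_mult)
    then show ?thesis by (simp add: H_def mult_ac)
  qed
  have "(\<integral>\<^sup>+z. ennreal ((cmod (wavelet_transform (ft \<Psi>) \<phi> z))\<^sup>2) \<partial>affG_haar)
    = (\<integral>\<^sup>+s. (\<integral>\<^sup>+x. ennreal ((cmod (wavelet_transform (ft \<Psi>) \<phi> (x, s)))\<^sup>2) \<partial>lborel) * (ennreal (1 / s^3) * indicator {0<..} s) \<partial>lborel)"
    by (rule nn_integral_haar) measurable
  also have "\<dots> = (\<integral>\<^sup>+s. (\<integral>\<^sup>+\<eta>. ennreal ((2*pi)\<^sup>2) * ennreal (u \<eta>) * (ennreal ((cmod (\<Psi> (s *\<^sub>R \<eta>)))\<^sup>2 / s) * indicator {0<..} s) \<partial>lborel) \<partial>lborel)"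
  proof (intro nn_integral_cong)
    fix s :: real
    show "(\<integral>\<^sup>+x. ennreal ((cmod (wavelet_transform (ft \<Psi>) \<phi> (x, s)))\<^sup>2) \<partial>lborel) * (ennreal (1 / s^3) * indicator {0<..} s)
      = (\<integral>\<^sup>+\<eta>. ennreal ((2*pi)\<^sup>2) * ennreal (u \<eta>) * (ennreal ((cmod (\<Psi> (s *\<^sub>R \<eta>)))\<^sup>2 / s) * indicator {0<..} s) \<partial>lborel)"
    proof (cases "s > 0")
      case True
      have "(\<integral>\<^sup>+x. ennreal ((cmod (wavelet_transform (ft \<Psi>) \<phi> (x, s)))\<^sup>2) \<partial>lborel) = (\<integral>\<^sup>+x. ennreal ((cmod (ft (H s) x))\<^sup>2) \<partial>lborel)"
        unfolding H_def wavelet_transform_of_Linf_c[OF \<Psi> \<phi> True] ..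
      also have "\<dots> = ennreal ((2*pi)\<^sup>2) * (\<integral>\<^sup>+\<eta>. ennreal ((cmod (H s \<eta>))\<^sup>2) \<partial>lborel)"
        using plancherel[OF H[OF True]] by simp
      also have "\<dots> * (ennreal (1 / s^3) * indicator {0<..} s) = 
         (\<integral>\<^sup>+\<eta>. ennreal ((2*pi)\<^sup>2) * (ennreal ((cmod (H s \<eta>))\<^sup>2) * ennreal (1 / s^3)) \<partial>lborel)"
        using True H[OF True, THEN Linf_c_measurable]
        by (simp add: nn_integral_cmult nn_integral_multc mult.assoc)
      also have "\<dots> = (\<integral>\<^sup>+\<eta>. ennreal ((2*pi)\<^sup>2) * ennreal (u \<eta>) * (ennreal ((cmod (\<Psi> (s *\<^sub>R \<eta>)))\<^sup>2 / s) * indicator {0<..} s) \<partial>lborel)"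
      proof (intro nn_integral_cong)
        fix \<eta>
        have "(cmod (H s \<eta>))\<^sup>2 * (1 / s^3) = u \<eta> * ((cmod (\<Psi> (s *\<^sub>R \<eta>)))\<^sup>2 / s)"
          using True by (simp add: H_def u_def norm_mult power_mult_distrib power2_eq_square power3_eq_cube)
        then show "ennreal ((2*pi)\<^sup>2) * (ennreal ((cmod (H s \<eta>))\<^sup>2) * ennreal (1 / s^3)) =
          ennreal ((2*pi)\<^sup>2) * ennreal (u \<eta>) * (ennreal ((cmod (\<Psi> (s *\<^sub>R \<eta>)))\<^sup>2 / s) * indicator {0<..} s)"
          using True by (simp add: mult.assoc u_def flip: ennreal_mult')
      qed
      finally show ?thesis .
    qed simp
  qed
  also have "\<dots> = (\<integral>\<^sup>+\<eta>. (\<integral>\<^sup>+s. ennreal ((2*pi)\<^sup>2) * ennreal (u \<eta>) * (ennreal ((cmod (\<Psi> (s *\<^sub>R \<eta>)))\<^sup>2 / s) * indicator {0<..} s) \<partial>lborel) \<partial>lborel)"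
    by (rule lborel_pair.Fubini') measurable
  also have "\<dots> = (\<integral>\<^sup>+\<eta>. ennreal ((2*pi)\<^sup>2) * ennreal (u \<eta>) * ennreal (1 / (2*pi)^4) \<partial>lborel)"
  proof (rule nn_integral_cong_AE, rule AE_mp[OF AE_lborel_singleton[of 0]], intro AE_I2 impI)
    fix \<eta> :: "real^2" assume "\<eta> \<noteq> 0"
    then show "(\<integral>\<^sup>+s. ennreal ((2*pi)\<^sup>2) * ennreal (u \<eta>) * (ennreal ((cmod (\<Psi> (s *\<^sub>R \<eta>)))\<^sup>2 / s) * indicator {0<..} s) \<partial>lborel)
       = ennreal ((2*pi)\<^sup>2) * ennreal (u \<eta>) * ennreal (1 / (2*pi)^4)"
      using adm by (subst nn_integral_cmult) (simp_all add: admissible_def)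
  qed
  also have "\<dots> = ennreal ((2*pi)\<^sup>2) * ennreal (1 / (2*pi)^4) * (\<integral>\<^sup>+\<eta>. ennreal (u \<eta>) \<partial>lborel)"
    by (subst nn_integral_cmult[symmetric]) (simp_all add: mult_ac)
  also have "(\<integral>\<^sup>+\<eta>. ennreal (u \<eta>) \<partial>lborel) = (\<integral>\<^sup>+\<eta>. ennreal ((cmod (ft \<phi> \<eta>))\<^sup>2) \<partial>lborel)"
    unfolding u_def by (subst (2) nn_integral_lborel_affine[where c="-1" and t=0]) simp_all
  also have "\<dots> = ennreal ((2*pi)\<^sup>2) * (\<integral>\<^sup>+x. ennreal ((cmod (\<phi> x))\<^sup>2) \<partial>lborel)"
    using plancherel[OF \<phi>] by simp
  also have "ennreal ((2*pi)\<^sup>2) * ennreal (1 / (2*pi)^4) * \<dots> =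
    ennreal ((2*pi)\<^sup>2) * ennreal (1 / (2*pi)^4) * ennreal ((2*pi)\<^sup>2) * (\<integral>\<^sup>+x. ennreal ((cmod (\<phi> x))\<^sup>2) \<partial>lborel)"
    by (simp only: mult.assoc)
  also have "ennreal ((2*pi)\<^sup>2) * ennreal (1 / (2*pi)^4) * ennreal ((2*pi)\<^sup>2) = ennreal ((2*pi)\<^sup>2 * (1 / (2*pi)^4) * (2*pi)\<^sup>2)"
    by (subst ennreal_mult[symmetric], simp, simp)+ simp
  also have "(2*pi)\<^sup>2 * (1 / (2*pi)^4) * (2*pi)\<^sup>2 = 1"
    by (simp add: field_simps flip: power_add)
  finally show ?thesis by simp
qed

text \<open>Fatou's lemma in the form used for both halves of the isometry.\<close>

lemma nn_integral_le_of_tendsto: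
  fixes f :: "nat \<Rightarrow> 'a \<Rightarrow> ennreal"
  assumes "\<And>n. f n \<in> borel_measurable M" "\<And>x. x \<in> space M \<Longrightarrow> (\<lambda>n. f n x) \<longlonglongrightarrow> g x"
    and "\<And>n. (\<integral>\<^sup>+x. f n x \<partial>M) \<le> C"
  shows "(\<integral>\<^sup>+x. g x \<partial>M) \<le> C"
proof -
  have "(\<integral>\<^sup>+x. g x \<partial>M) = (\<integral>\<^sup>+x. liminf (\<lambda>n. f n x) \<partial>M)"
    using assms(2) by (intro nn_integral_cong lim_imp_Liminf[symmetric]) auto
  also have "\<dots> \<le> liminf (\<lambda>n. \<integral>\<^sup>+x. f n x \<partial>M)"
    by (rule nn_integral_liminf) (fact assms(1))
  also have "\<dots> \<le> C"
    using assms(3) by (intro Liminf_le) auto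
  finally show ?thesis .
qed

lemma integrable_wavelet_integrand:
  assumes \<Psi>: "\<Psi> \<in> Linf_c" and \<phi>: "\<phi> \<in> L2_fun lborel" and z: "z \<in> affG"
  shows "integrable lborel (\<lambda>y. \<phi> y * cnj (quasi_regular z (ft \<Psi>) y))"
  unfolding quasi_regular_ft[OF z]
proof (rule integrable_mult_cnj)
  show "integrable lborel (\<lambda>y. (cmod (ft (dilmod \<Psi> z) y))\<^sup>2)"
    by (rule ft_square_integrable[OF Linf_c_dilmod[OF \<Psi> z]])
  show "ft (dilmod \<Psi> z) \<in> borel_measurable lborel"
    using ft_measurable[OF Linf_c_measurable[OF Linf_c_dilmod[OF \<Psi> z]]] by simp
qed (use \<phi> in \<open>auto simp: L2_fun_def\<close>)

text \<open>Passage from \<open>Linf_c\<close> to \<open>L\<^sup>2\<close>. Truncations \<open>\<phi>\<^sub>n\<close> of \<open>\<phi>\<close> have transforms that converge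
  pointwise, so Fatou gives the contraction property. For the opposite inequality, \<open>\<phi>\<^sub>n\<close> and \<open>\<phi> - \<phi>\<^sub>n\<close> have
  disjoint supports, and the reflected function \<open>2\<phi>\<^sub>n - \<phi>\<close> has the same absolute value as \<open>\<phi>\<close>. The parallelogram law for the
  transforms bounds \<open>2\<parallel>\<phi>\<^sub>n\<parallel>\<^sup>2\<close> by the energies of the transforms of \<open>\<phi>\<close> and of \<open>2\<phi>\<^sub>n - \<phi>\<close>, and
  the latter is at most \<open>\<parallel>\<phi>\<parallel>\<^sup>2\<close> by contraction.\<close>

theorem isometric_wavelet_ft:
  assumes \<Psi>: "\<Psi> \<in> Linf_c" and adm: "admissible \<Psi>"
  shows "isometric_wavelet (ft \<Psi>)"
  unfolding isometric_wavelet_def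
proof (intro ballI)
  note Linf_c_measurable[OF \<Psi>, measurable]
  define E where "E \<phi> = (\<integral>\<^sup>+z. ennreal ((cmod (wavelet_transform (ft \<Psi>) \<phi> z))\<^sup>2) \<partial>affG_haar)" for \<phi>
  define N where "N \<phi> = (\<integral>\<^sup>+x. ennreal ((cmod (\<phi> x))\<^sup>2) \<partial>lborel)" for \<phi> :: "real^2 \<Rightarrow> complex"
  define S where "S n \<phi> = {x :: real^2. cmod (\<phi> x) \<le> real n \<and> norm x \<le> real n}" for n and \<phi> :: "real^2 \<Rightarrow> complex"
  define tr where "tr n \<phi> x = (if x \<in> S n \<phi> then \<phi> x else 0)" for n and \<phi> :: "real^2 \<Rightarrow> complex" and x
  have tr_meas [measurable]: "tr n \<phi> \<in> borel_measurable borel" if [measurable]: "\<phi> \<in> borel_measurable borel" for n \<phi>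
    unfolding tr_def S_def by measurable
  have tr: "tr n \<phi> \<in> Linf_c" if "\<phi> \<in> borel_measurable borel" for n \<phi>
    by (rule Linf_cI[OF tr_meas[OF that], where M="real n" and R="real n"]) (auto simp: tr_def S_def)
  have tr_le: "cmod (tr n \<phi> x) \<le> cmod (\<phi> x)" for n \<phi> x
    by (simp add: tr_def)
  have tr_lim: "(\<lambda>n. tr n \<phi> x) \<longlonglongrightarrow> \<phi> x" for \<phi> x
  proof (rule tendsto_eventually)
    have "\<forall>\<^sub>F n in sequentially. cmod (\<phi> x) + norm x \<le> real n"
      using filterlim_real_sequentially unfolding filterlim_at_top by blast
    then show "\<forall>\<^sub>F n in sequentially. tr n \<phi> x = \<phi> x"
    proof eventually_elim
      case (elim n)
      then have "cmod (\<phi> x) \<le> real n" "norm x \<le> real n"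
        using norm_ge_zero[of x] norm_ge_zero[of "\<phi> x"] by linarith+
      then show ?case by (simp add: tr_def S_def)
    qed
  qed
  have L2_tr: "tr n \<phi> \<in> L2_fun lborel" if "\<phi> \<in> L2_fun lborel" for n \<phi>
    using that Linf_c_square_integrable[OF tr] by (auto simp: L2_fun_def)
  have W_lim: "(\<lambda>n. wavelet_transform (ft \<Psi>) (tr n \<phi>) z) \<longlonglongrightarrow> wavelet_transform (ft \<Psi>) \<phi> z"
    if \<phi>: "\<phi> \<in> L2_fun lborel" and z: "z \<in> affG" for \<phi> z
    unfolding wavelet_transform_def L2_inner_def
  proof (rule integral_dominated_convergence[where w="\<lambda>y. cmod (\<phi> y * cnj (quasi_regular z (ft \<Psi>) y))"])
    have [measurable]: "\<phi> \<in> borel_measurable borel" using \<phi> by (simp add: L2_fun_def)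
    show "integrable lborel (\<lambda>y. cmod (\<phi> y * cnj (quasi_regular z (ft \<Psi>) y)))"
      by (intro integrable_norm integrable_wavelet_integrand \<Psi> \<phi> z)
    show "AE y in lborel. (\<lambda>n. tr n \<phi> y * cnj (quasi_regular z (ft \<Psi>) y)) \<longlonglongrightarrow> \<phi> y * cnj (quasi_regular z (ft \<Psi>) y)"
      by (intro AE_I2 tendsto_intros tr_lim)
    show "AE y in lborel. norm (tr n \<phi> y * cnj (quasi_regular z (ft \<Psi>) y)) \<le> cmod (\<phi> y * cnj (quasi_regular z (ft \<Psi>) y))" for n
      unfolding norm_mult by (intro AE_I2 mult_right_mono tr_le norm_ge_zero)
    show "(\<lambda>y. \<phi> y * cnj (quasi_regular z (ft \<Psi>) y)) \<in> borel_measurable lborel" by measurable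
    show "(\<lambda>y. tr n \<phi> y * cnj (quasi_regular z (ft \<Psi>) y)) \<in> borel_measurable lborel" for n by measurable
  qed
  have E_meas: "(\<lambda>z. ennreal ((cmod (wavelet_transform (ft \<Psi>) \<phi> z))\<^sup>2)) \<in> borel_measurable affG_haar"
    if [measurable]: "\<phi> \<in> borel_measurable borel" for \<phi>
    by (rule borel_measurable_haarI) measurable
  have E_le: "E \<phi> \<le> N \<phi>" if \<phi>: "\<phi> \<in> L2_fun lborel" for \<phi>
    unfolding E_def
  proof (rule nn_integral_le_of_tendsto)
    have \<phi>': "\<phi> \<in> borel_measurable borel" using \<phi> by (simp add: L2_fun_def)
    show "(\<lambda>z. ennreal ((cmod (wavelet_transform (ft \<Psi>) (tr n \<phi>) z))\<^sup>2)) \<in> borel_measurable affG_haar" for n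
      by (rule E_meas[OF tr_meas[OF \<phi>']])
    show "(\<lambda>n. ennreal ((cmod (wavelet_transform (ft \<Psi>) (tr n \<phi>) z))\<^sup>2)) \<longlonglongrightarrow> ennreal ((cmod (wavelet_transform (ft \<Psi>) \<phi> z))\<^sup>2)"
      if "z \<in> space affG_haar" for z
      using that by (intro tendsto_ennrealI tendsto_intros W_lim \<phi>) simp
    show "(\<integral>\<^sup>+z. ennreal ((cmod (wavelet_transform (ft \<Psi>) (tr n \<phi>) z))\<^sup>2) \<partial>affG_haar) \<le> N \<phi>" for n
      unfolding wavelet_isometric_on_Linf_c[OF \<Psi> adm tr[OF \<phi>']] N_def
      by (intro nn_integral_mono ennreal_leI power_mono tr_le norm_ge_zero)
  qed
  fix \<phi> :: "real^2 \<Rightarrow> complex" assume \<phi>: "\<phi> \<in> L2_fun lborel"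
  then have \<phi>': "\<phi> \<in> borel_measurable borel" and N_eq: "N \<phi> = ennreal (\<integral>x. (cmod (\<phi> x))\<^sup>2 \<partial>lborel)"
    by (auto simp: L2_fun_def N_def nn_integral_eq_integral)
  note \<phi>'[measurable]
  define mirror where "mirror n x = 2 * tr n \<phi> x - \<phi> x" for n x
  have mirror_norm: "cmod (mirror n x) = cmod (\<phi> x)" for n x
    by (simp add: mirror_def tr_def)
  have mirror_meas [measurable]: "mirror n \<in> borel_measurable borel" for n
    unfolding mirror_def by measurable
  have mirror: "mirror n \<in> L2_fun lborel" for n
    using \<phi> by (simp add: L2_fun_def mirror_norm)
  have "(\<integral>\<^sup>+x. 2 * ennreal ((cmod (\<phi> x))\<^sup>2) \<partial>lborel) \<le> E \<phi> + N \<phi>"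
  proof (rule nn_integral_le_of_tendsto)
    show "(\<lambda>x. 2 * ennreal ((cmod (tr n \<phi> x))\<^sup>2)) \<in> borel_measurable lborel" for n by measurable
    show "(\<lambda>n. 2 * ennreal ((cmod (tr n \<phi> x))\<^sup>2)) \<longlonglongrightarrow> 2 * ennreal ((cmod (\<phi> x))\<^sup>2)" for x
      by (intro ennreal_tendsto_cmult tendsto_ennrealI tendsto_intros tr_lim) simp
    show "(\<integral>\<^sup>+x. 2 * ennreal ((cmod (tr n \<phi> x))\<^sup>2) \<partial>lborel) \<le> E \<phi> + N \<phi>" for n
    proof -
      have "(\<integral>\<^sup>+x. 2 * ennreal ((cmod (tr n \<phi> x))\<^sup>2) \<partial>lborel) = 2 * E (tr n \<phi>)"
        unfolding E_def wavelet_isometric_on_Linf_c[OF \<Psi> adm tr[OF \<phi>']] by (rule nn_integral_cmult) measurable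
      also have "\<dots> = (\<integral>\<^sup>+z. 2 * ennreal ((cmod (wavelet_transform (ft \<Psi>) (tr n \<phi>) z))\<^sup>2) \<partial>affG_haar)"
        unfolding E_def by (rule nn_integral_cmult[symmetric]) (rule E_meas[OF tr_meas[OF \<phi>']])
      also have "\<dots> \<le> (\<integral>\<^sup>+z. ennreal ((cmod (wavelet_transform (ft \<Psi>) \<phi> z))\<^sup>2) + ennreal ((cmod (wavelet_transform (ft \<Psi>) (mirror n) z))\<^sup>2) \<partial>affG_haar)"
      proof (rule nn_integral_mono)
        fix z assume "z \<in> space affG_haar"
        then have z: "z \<in> affG" by simp
        define a where "a = wavelet_transform (ft \<Psi>) (tr n \<phi>) z"
        define b where "b = wavelet_transform (ft \<Psi>) \<phi> z"
        have r: "wavelet_transform (ft \<Psi>) (mirror n) z = 2 * a - b"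
          unfolding a_def b_def wavelet_transform_def L2_inner_def
          using integrable_wavelet_integrand[OF \<Psi> \<phi> z] integrable_wavelet_integrand[OF \<Psi> L2_tr[OF \<phi>] z]
          unfolding integral_mult_right_zero[symmetric]
          by (subst Bochner_Integration.integral_diff[symmetric]) 
             (auto simp: mirror_def algebra_simps intro!: Bochner_Integration.integral_cong)
        have "2 * (cmod a)\<^sup>2 \<le> (cmod b)\<^sup>2 + (cmod (2 * a - b))\<^sup>2"
        proof -
          have "(cmod b)\<^sup>2 + (cmod (2 * a - b))\<^sup>2 = 2 * (cmod a)\<^sup>2 + 2 * (cmod (b - a))\<^sup>2"
            unfolding cmod_power2 by (simp add: power2_eq_square algebra_simps)
          then show ?thesis by simp
        qed
        then show "2 * ennreal ((cmod (wavelet_transform (ft \<Psi>) (tr n \<phi>) z))\<^sup>2) \<le> 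
          ennreal ((cmod (wavelet_transform (ft \<Psi>) \<phi> z))\<^sup>2) + ennreal ((cmod (wavelet_transform (ft \<Psi>) (mirror n) z))\<^sup>2)"
          unfolding r a_def[symmetric] b_def[symmetric]
          by (simp flip: ennreal_plus ennreal_numeral ennreal_mult')
      qed
      also have "\<dots> = E \<phi> + E (mirror n)"
        unfolding E_def by (rule nn_integral_add) (rule E_meas[OF \<phi>'], rule E_meas[OF mirror_meas])
      also have "\<dots> \<le> E \<phi> + N (mirror n)"
        by (intro add_left_mono E_le mirror)
      also have "N (mirror n) = N \<phi>" by (simp add: N_def mirror_norm)
      finally show ?thesis .
    qed
  qed
  moreover have "(\<integral>\<^sup>+x. 2 * ennreal ((cmod (\<phi> x))\<^sup>2) \<partial>lborel) = 2 * N \<phi>"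
    unfolding N_def by (rule nn_integral_cmult) measurable
  ultimately have "N \<phi> + N \<phi> \<le> E \<phi> + N \<phi>"
    by (simp only: mult_2)
  moreover have "N \<phi> \<noteq> top" unfolding N_eq by simp
  ultimately have "N \<phi> \<le> E \<phi>"
    by (simp add: add.commute[of "E \<phi>"] ennreal_add_left_cancel_le)
  with E_le[OF \<phi>] have E_eq: "E \<phi> = N \<phi>"
    by (rule antisym)
  have meas: "wavelet_transform (ft \<Psi>) \<phi> \<in> borel_measurable affG_haar"
    by (rule borel_measurable_haarI) measurable
  have meas2: "(\<lambda>z. (cmod (wavelet_transform (ft \<Psi>) \<phi> z))\<^sup>2) \<in> borel_measurable affG_haar"
    by (rule borel_measurable_haarI) measurable
  have "integrable affG_haar (\<lambda>z. (cmod (wavelet_transform (ft \<Psi>) \<phi> z))\<^sup>2)"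
    using E_eq meas2 unfolding N_eq E_def by (intro integrableI_bounded) auto
  moreover have "(\<integral>z. (cmod (wavelet_transform (ft \<Psi>) \<phi> z))\<^sup>2 \<partial>affG_haar) = (\<integral>x. (cmod (\<phi> x))\<^sup>2 \<partial>lborel)"
    using E_eq meas2 unfolding N_eq E_def by (subst integral_eq_nn_integral) auto
  ultimately show "wavelet_transform (ft \<Psi>) \<phi> \<in> L2_fun affG_haar \<and> 
      L2_norm affG_haar (wavelet_transform (ft \<Psi>) \<phi>) = L2_norm lborel \<phi>"
    using meas by (simp add: L2_fun_def L2_norm_def)
qed

section \<open>A radial wavelet and its sign-modified companion\<close>

definition annulus :: "(real^2) set" where "annulus = {\<xi>. 2 \<le> norm \<xi> \<and> norm \<xi> \<le> 3}"

text \<open>A convolution of indicator functions is continuous, and its Fourier transform is a product of two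
  square integrable functions, hence integrable. The radii keep the support away from the origin.\<close>

definition bump :: "real^2 \<Rightarrow> complex" where
  "bump = conv (indicator annulus) (indicator (cball 0 1))"

lemma annulus_borel [measurable]: "annulus \<in> sets borel"
  unfolding annulus_def by measurable

lemma Linf_c_annulus: "(indicator annulus :: real^2 \<Rightarrow> complex) \<in> Linf_c"
  by (rule Linf_cI[OF borel_measurable_indicator, of _ 1 3]) (auto simp: indicator_def annulus_def)

lemma Linf_c_disc: "(indicator (cball 0 1) :: real^2 \<Rightarrow> complex) \<in> Linf_c"
  by (rule Linf_cI[OF borel_measurable_indicator, of _ 1 1]) (auto simp: indicator_def)

lemma Linf_c_bump: "bump \<in> Linf_c"
  unfolding bump_def by (intro Linf_c_conv Linf_c_annulus Linf_c_disc)

lemma bump_continuous: "continuous_on UNIV bump"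
  unfolding bump_def by (intro conv_continuous Linf_c_annulus Linf_c_disc)

definition overlap :: "real^2 \<Rightarrow> (real^2) set" where
  "overlap \<xi> = {y. norm y \<le> 1 \<and> \<xi> - y \<in> annulus}"

lemma overlap_borel [measurable]: "overlap \<xi> \<in> sets borel"
  unfolding overlap_def annulus_def by measurable

text \<open>Rotation invariance and lower bounds of \<open>bump\<close> are read off from the area of an intersection.\<close>

lemma bump_eq_overlap: "bump \<xi> = of_real (measure lborel (overlap \<xi>))"
proof -
  have "bump \<xi> = (\<integral>y. of_real (indicator (overlap \<xi>) y) \<partial>lborel)"
    unfolding bump_def conv_def by (intro Bochner_Integration.integral_cong refl) (auto simp: indicator_def overlap_def)
  then show ?thesis by simp
qed

lemma overlap_fmeasurable: "overlap \<xi> \<in> fmeasurable lborel"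
proof (rule fmeasurableI2)
  show "cball (0::real^2) 1 \<in> fmeasurable lborel"
    by (rule fmeasurableI) (use emeasure_bounded_finite[OF bounded_cball, of "0::real^2" 1] in auto)
  show "overlap \<xi> \<subseteq> cball 0 1" by (auto simp: overlap_def)
qed simp

lemma bump_radial:
  assumes "norm \<xi> = norm \<xi>'" shows "bump \<xi> = bump \<xi>'"
proof -
  obtain T where T: "orthogonal_transformation T" "T \<xi> = \<xi>'"
    using orthogonal_transformation_exists[OF assms] by blast
  have lin: "linear T" and surj: "surj T" and norm: "\<And>x. norm (T x) = norm x"
    using T by (auto simp: orthogonal_transformation_linear orthogonal_transformation_surj orthogonal_transformation_norm)
  have mem: "T y \<in> overlap \<xi>' \<longleftrightarrow> y \<in> overlap \<xi>" for y
  proof -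
    have "\<xi>' - T y = T (\<xi> - y)" using linear_diff[OF lin] T by simp
    then show ?thesis by (simp add: overlap_def annulus_def norm)
  qed
  have "overlap \<xi>' = T ` overlap \<xi>"
  proof (intro equalityI subsetI)
    fix x assume x: "x \<in> overlap \<xi>'"
    obtain y where "x = T y" using surj by (metis surjD)
    with x mem show "x \<in> T ` overlap \<xi>" by blast
  qed (use mem in blast)
  moreover have "overlap \<xi> \<in> lmeasurable"
    using overlap_fmeasurable[of \<xi>] by (auto simp: fmeasurable_def)
  ultimately have "measure lebesgue (overlap \<xi>') = measure lebesgue (overlap \<xi>)"
    using measure_orthogonal_image[OF T(1)] by simp
  then show ?thesis
    by (simp add: bump_eq_overlap measure_completion)
qed

lemma bump_eq_0:
  assumes "norm \<xi> < 1 \<or> norm \<xi> > 4" shows "bump \<xi> = 0"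
proof -
  have "overlap \<xi> = {}"
  proof -
    have False if y: "norm y \<le> 1" "2 \<le> norm (\<xi> - y)" "norm (\<xi> - y) \<le> 3" for y
      using assms y norm_triangle_ineq4[of \<xi> y] norm_triangle_ineq[of "\<xi> - y" y] by auto
    then show ?thesis by (auto simp: overlap_def annulus_def)
  qed
  then show ?thesis by (simp add: bump_eq_overlap)
qed

definition bump_min :: real where "bump_min = measure lborel (cball (0::real^2) (1/4))"

lemma bump_min_pos: "bump_min > 0"
  unfolding bump_min_def using content_cball_pos[of "1/4" "0::real^2"] by simp

lemma bump_ge:
  assumes "9/4 \<le> norm \<xi>" "norm \<xi> \<le> 11/4" shows "bump_min \<le> cmod (bump \<xi>)"
proof -
  have "cball 0 (1/4) \<subseteq> overlap \<xi>"
  proof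
    fix y :: "real^2" assume "y \<in> cball 0 (1/4)"
    then have "norm y \<le> 1/4" by simp
    then show "y \<in> overlap \<xi>"
      using assms norm_triangle_ineq4[of \<xi> y] norm_triangle_ineq2[of \<xi> y] by (auto simp: overlap_def annulus_def)
  qed
  then have "bump_min \<le> measure lborel (overlap \<xi>)"
    unfolding bump_min_def by (intro measure_mono_fmeasurable overlap_fmeasurable) auto
  then show ?thesis by (simp add: bump_eq_overlap)
qed

definition bump_energy :: ennreal where
  "bump_energy = (\<integral>\<^sup>+t. ennreal ((cmod (bump (t *\<^sub>R axis 1 1)))\<^sup>2 / t) * indicator {0<..} t \<partial>lborel)"

text \<open>The measure \<open>ds/s\<close> is invariant under dilation and \<open>bump\<close> is radial, so all rays carry the same
  energy.\<close>

lemma bump_ray_energy: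
  assumes "\<eta> \<noteq> 0"
  shows "(\<integral>\<^sup>+s. ennreal ((cmod (bump (s *\<^sub>R \<eta>)))\<^sup>2 / s) * indicator {0<..} s \<partial>lborel) = bump_energy"
proof -
  note Linf_c_measurable[OF Linf_c_bump, measurable]
  define r where "r = norm \<eta>"
  have r: "r > 0" using assms by (simp add: r_def)
  have eq: "cmod (bump ((t / r) *\<^sub>R \<eta>)) = cmod (bump (t *\<^sub>R axis 1 1))" for t :: real
    using r by (intro arg_cong[where f=cmod] bump_radial) (simp add: r_def)
  have "(\<integral>\<^sup>+s. ennreal ((cmod (bump (s *\<^sub>R \<eta>)))\<^sup>2 / s) * indicator {0<..} s \<partial>lborel)
     = ennreal (1/r) * (\<integral>\<^sup>+t. ennreal ((cmod (bump ((t / r) *\<^sub>R \<eta>)))\<^sup>2 / (t / r)) * indicator {0<..} (t / r) \<partial>lborel)"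
    using r by (subst nn_integral_real_affine[where c="1/r" and t=0]) simp_all
  also have "\<dots> = (\<integral>\<^sup>+t. ennreal (1/r) * (ennreal ((cmod (bump ((t / r) *\<^sub>R \<eta>)))\<^sup>2 / (t / r)) * indicator {0<..} (t / r)) \<partial>lborel)"
    by (rule nn_integral_cmult[symmetric]) measurable
  also have "\<dots> = bump_energy"
    unfolding bump_energy_def
  proof (intro nn_integral_cong)
    fix t :: real
    show "ennreal (1/r) * (ennreal ((cmod (bump ((t / r) *\<^sub>R \<eta>)))\<^sup>2 / (t / r)) * indicator {0<..} (t / r))
      = ennreal ((cmod (bump (t *\<^sub>R axis 1 1)))\<^sup>2 / t) * indicator {0<..} t"
      unfolding eq using r by (cases "t > 0") (simp_all add: indicator_def zero_less_divide_iff flip: ennreal_mult')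
  qed
  finally show ?thesis .
qed

lemma bump_energy_bounds: "0 < bump_energy" "bump_energy < \<infinity>"
proof -
  obtain M R where M: "M > 0" "\<And>x. cmod (bump x) \<le> M" by (rule Linf_cE[OF Linf_c_bump]) blast
  have "bump_energy \<le> (\<integral>\<^sup>+t. ennreal (M\<^sup>2) * indicator {1..4::real} t \<partial>lborel)"
    unfolding bump_energy_def
  proof (intro nn_integral_mono)
    fix t :: real
    show "ennreal ((cmod (bump (t *\<^sub>R axis 1 1)))\<^sup>2 / t) * indicator {0<..} t \<le> ennreal (M\<^sup>2) * indicator {1..4} t"
    proof (cases "t \<in> {1..4}")
      case True
      have "(cmod (bump (t *\<^sub>R axis 1 1)))\<^sup>2 / t \<le> (cmod (bump (t *\<^sub>R axis 1 1)))\<^sup>2 / 1"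
        using True by (intro divide_left_mono) auto
      also have "\<dots> \<le> M\<^sup>2" using M by (simp add: power_mono)
      finally show ?thesis using True by (auto simp: indicator_def intro!: ennreal_leI)
    next
      case False
      then have "t > 0 \<Longrightarrow> bump (t *\<^sub>R axis 1 1) = 0" by (intro bump_eq_0) auto
      then show ?thesis by (auto simp: indicator_def)
    qed
  qed
  also have "\<dots> < \<infinity>" by (simp add: nn_integral_cmult_indicator ennreal_mult_less_top)
  finally show "bump_energy < \<infinity>" .
  have "0 < ennreal (bump_min\<^sup>2 / 3 * (1/2))"
    using bump_min_pos by simp
  also have "\<dots> = ennreal (bump_min\<^sup>2 / 3) * ennreal (1/2)"
    by (rule ennreal_mult) auto
  also have "ennreal (1/2) = emeasure lborel {9/4..11/4::real}"
    by (subst emeasure_lborel_Icc) auto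
  also have "ennreal (bump_min\<^sup>2 / 3) * emeasure lborel {9/4..11/4::real} = (\<integral>\<^sup>+t. ennreal (bump_min\<^sup>2 / 3) * indicator {9/4..11/4::real} t \<partial>lborel)"
    by (rule nn_integral_cmult_indicator[symmetric]) simp
  also have "\<dots> \<le> bump_energy"
    unfolding bump_energy_def
  proof (intro nn_integral_mono)
    fix t :: real
    show "ennreal (bump_min\<^sup>2 / 3) * indicator {9/4..11/4} t \<le> ennreal ((cmod (bump (t *\<^sub>R axis 1 1)))\<^sup>2 / t) * indicator {0<..} t"
    proof (cases "t \<in> {9/4..11/4}")
      case True
      then have "bump_min \<le> cmod (bump (t *\<^sub>R axis 1 1))" by (intro bump_ge) auto
      then have "bump_min\<^sup>2 / 3 \<le> (cmod (bump (t *\<^sub>R axis 1 1)))\<^sup>2 / t"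
        using True bump_min_pos by (intro frac_le power_mono) auto
      with True show ?thesis by (auto simp: indicator_def intro!: ennreal_leI)
    qed simp
  qed
  finally show "0 < bump_energy" .
qed

definition Fhat :: "real^2 \<Rightarrow> complex" where
  "Fhat \<xi> = of_real (1 / (sqrt (enn2real bump_energy) * (2*pi)\<^sup>2)) * bump \<xi>"

text \<open>Unimodular everywhere, also on the line where it jumps, and invariant under positive dilations.\<close>

definition half_sgn :: "real^2 \<Rightarrow> complex" where
  "half_sgn \<xi> = (if \<xi> $ 1 > 0 then 1 else -1)"

definition Ghat :: "real^2 \<Rightarrow> complex" where
  "Ghat \<xi> = Fhat \<xi> * half_sgn \<xi>"

lemma half_sgn_measurable [measurable]: "half_sgn \<in> borel_measurable borel"
  unfolding half_sgn_def[abs_def] by measurable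

lemma norm_half_sgn [simp]: "cmod (half_sgn \<xi>) = 1"
  by (simp add: half_sgn_def)

lemma half_sgn_scale: "s > 0 \<Longrightarrow> half_sgn (s *\<^sub>R \<xi>) = half_sgn \<xi>"
  by (simp add: half_sgn_def zero_less_mult_iff)

lemma Linf_c_Fhat: "Fhat \<in> Linf_c"
  unfolding Fhat_def[abs_def] by (intro Linf_c_cmult Linf_c_bump)

lemma Linf_c_Ghat: "Ghat \<in> Linf_c"
  unfolding Ghat_def[abs_def] by (intro Linf_c_mult[of _ _ 1] Linf_c_Fhat) auto

lemma Fhat_continuous: "continuous_on UNIV Fhat"
  unfolding Fhat_def[abs_def] by (intro continuous_intros bump_continuous)

lemma Fhat_eq_0: "norm \<xi> < 1 \<or> norm \<xi> > 4 \<Longrightarrow> Fhat \<xi> = 0"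
  by (simp add: Fhat_def bump_eq_0)

lemma energy_real: "bump_energy = ennreal (enn2real bump_energy)" "enn2real bump_energy > 0"
  using bump_energy_bounds by (auto simp: enn2real_positive_iff less_top)

lemma Fhat_nonzero:
  assumes "9/4 \<le> norm \<xi>" "norm \<xi> \<le> 11/4" shows "Fhat \<xi> \<noteq> 0"
  using bump_ge[OF assms] bump_min_pos energy_real(2) by (auto simp: Fhat_def)

lemma admissible_Fhat: "admissible Fhat"
  unfolding admissible_def
proof (intro allI impI)
  fix \<eta> :: "real^2" assume \<eta>: "\<eta> \<noteq> 0"
  note Linf_c_measurable[OF Linf_c_bump, measurable]
  define k where "k = enn2real bump_energy"
  have k: "k > 0" "bump_energy = ennreal k" using energy_real by (simp_all add: k_def)
  have *: "(cmod (Fhat \<xi>))\<^sup>2 = (1 / (k * (2*pi)^4)) * (cmod (bump \<xi>))\<^sup>2" for \<xi>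
    using k by (simp add: Fhat_def norm_mult norm_divide norm_power power_mult_distrib power_divide flip: k_def power_mult)
  have "(\<integral>\<^sup>+s. ennreal ((cmod (Fhat (s *\<^sub>R \<eta>)))\<^sup>2 / s) * indicator {0<..} s \<partial>lborel)
    = (\<integral>\<^sup>+s. ennreal (1 / (k * (2*pi)^4)) * (ennreal ((cmod (bump (s *\<^sub>R \<eta>)))\<^sup>2 / s) * indicator {0<..} s) \<partial>lborel)"
    using k unfolding * by (intro nn_integral_cong) (simp add: indicator_def flip: ennreal_mult')
  also have "\<dots> = ennreal (1 / (k * (2*pi)^4)) * bump_energy"
    by (subst nn_integral_cmult) (simp_all add: bump_ray_energy[OF \<eta>])
  also have "\<dots> = ennreal (1 / (2*pi)^4)"
    unfolding k(2) using k(1) by (simp flip: ennreal_mult')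
  finally show "(\<integral>\<^sup>+s. ennreal ((cmod (Fhat (s *\<^sub>R \<eta>)))\<^sup>2 / s) * indicator {0<..} s \<partial>lborel) = ennreal (1 / (2*pi)^4)" .
qed

lemma admissible_Ghat: "admissible Ghat"
  using admissible_Fhat by (simp add: admissible_def Ghat_def norm_mult)

lemma L2_ft: "h \<in> Linf_c \<Longrightarrow> ft h \<in> L2_fun lborel"
  by (simp add: L2_fun_def ft_square_integrable ft_measurable Linf_c_measurable)

lemma wavelet_GG_eq_FF:
  assumes "z \<in> affG"
  shows "wavelet_transform (ft Ghat) (ft Ghat) z = wavelet_transform (ft Fhat) (ft Fhat) z"
proof -
  obtain x s where z: "z = (x, s)" and s: "s > 0" using assms by (auto simp: affG_def)
  have "Ghat \<eta> * cnj (Ghat (s *\<^sub>R \<eta>)) = Fhat \<eta> * cnj (Fhat (s *\<^sub>R \<eta>))" for \<eta>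
    using s by (simp add: Ghat_def half_sgn_scale) (simp add: half_sgn_def)
  then show ?thesis
    unfolding z by (simp add: wavelet_transform_of_ft s Linf_c_Fhat Linf_c_Ghat)
qed

text \<open>The transform of a convolution is the product of the transforms, each of them in \<open>L\<^sup>2\<close>.\<close>

lemma integrable_ft_Fhat: "integrable lborel (ft Fhat)"
proof -
  let ?A = "indicator annulus :: real^2 \<Rightarrow> complex" and ?B = "indicator (cball 0 1) :: real^2 \<Rightarrow> complex"
  note Linf_c_measurable[OF Linf_c_annulus, measurable] Linf_c_measurable[OF Linf_c_disc, measurable]
  define c where "c = complex_of_real (1 / (sqrt (enn2real bump_energy) * (2*pi)\<^sup>2))"
  have "ft Fhat = (\<lambda>x. c * (ft ?A x * cnj (cnj (ft ?B x))))"
  proof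
    fix x
    have "ft Fhat x = c * ft bump x"
      unfolding ft_def Fhat_def c_def[symmetric] mult.assoc by (rule integral_mult_right_zero)
    then show "ft Fhat x = c * (ft ?A x * cnj (cnj (ft ?B x)))"
      unfolding bump_def ft_conv[OF Linf_c_annulus Linf_c_disc] complex_cnj_cnj .
  qed
  moreover have "integrable lborel (\<lambda>x. ft ?A x * cnj (cnj (ft ?B x)))"
  proof (rule integrable_mult_cnj)
    show "integrable lborel (\<lambda>x. (cmod (cnj (ft ?B x)))\<^sup>2)"
      unfolding complex_mod_cnj by (rule ft_square_integrable[OF Linf_c_disc])
  qed (rule ft_square_integrable[OF Linf_c_annulus], measurable)
  ultimately show ?thesis
    by (simp only: integrable_mult_right)
qed

text \<open>At fixed scale the transform is a convolution of \<open>f\<close> with a dilate of its involution, and the \<open>L\<^sup>1\<close>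
  norm is submultiplicative.\<close>

lemma wavelet_L1_slice:
  fixes f :: "real^2 \<Rightarrow> complex"
  assumes f: "integrable lborel f" and s: "s > 0"
  shows "(\<integral>\<^sup>+x. ennreal (cmod (wavelet_transform f f (x, s))) \<partial>lborel)
    \<le> ennreal s * (\<integral>\<^sup>+y. ennreal (cmod (f y)) \<partial>lborel)\<^sup>2"
proof -
  have [measurable]: "f \<in> borel_measurable borel" using f by auto
  define I where "I = (\<integral>\<^sup>+y. ennreal (cmod (f y)) \<partial>lborel)"
  have "(\<integral>\<^sup>+x. ennreal (cmod (wavelet_transform f f (x, s))) \<partial>lborel)
    \<le> (\<integral>\<^sup>+x. (\<integral>\<^sup>+y. ennreal (cmod (f y)) * (ennreal (1/s) * ennreal (cmod (f ((1 / s) *\<^sub>R (y - x))))) \<partial>lborel) \<partial>lborel)"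
  proof (intro nn_integral_mono)
    fix x
    have "ennreal (cmod (wavelet_transform f f (x, s))) \<le> (\<integral>\<^sup>+y. ennreal (cmod (f y * cnj (quasi_regular (x, s) f y))) \<partial>lborel)"
    proof (cases "integrable lborel (\<lambda>y. f y * cnj (quasi_regular (x, s) f y))")
      case True
      then show ?thesis unfolding wavelet_transform_def L2_inner_def by (rule integral_norm_bound_ennreal)
    next
      case False
      then show ?thesis by (simp add: wavelet_transform_def L2_inner_def not_integrable_integral_eq)
    qed
    also have "\<dots> = (\<integral>\<^sup>+y. ennreal (cmod (f y)) * (ennreal (1/s) * ennreal (cmod (f ((1 / s) *\<^sub>R (y - x))))) \<partial>lborel)"
      using s by (intro nn_integral_cong) (simp add: quasi_regular_def norm_mult norm_divide flip: ennreal_mult')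
    finally show "ennreal (cmod (wavelet_transform f f (x, s))) \<le> \<dots>" .
  qed
  also have "\<dots> = (\<integral>\<^sup>+y. (\<integral>\<^sup>+x. ennreal (cmod (f y)) * (ennreal (1/s) * ennreal (cmod (f ((1 / s) *\<^sub>R (y - x))))) \<partial>lborel) \<partial>lborel)"
    by (rule lborel_pair.Fubini') measurable
  also have "\<dots> = (\<integral>\<^sup>+y. ennreal (cmod (f y)) * (ennreal s * I) \<partial>lborel)"
  proof (intro nn_integral_cong)
    fix y
    have "(\<integral>\<^sup>+x. ennreal (cmod (f ((1 / s) *\<^sub>R (y - x)))) \<partial>lborel) = ennreal (s\<^sup>2) * I"
      unfolding I_def using s by (subst nn_integral_lborel_affine[where c="-s" and t=y]) simp_all
    then have "(\<integral>\<^sup>+x. ennreal (cmod (f y)) * (ennreal (1/s) * ennreal (cmod (f ((1 / s) *\<^sub>R (y - x))))) \<partial>lborel)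
      = ennreal (cmod (f y)) * (ennreal (1/s) * ennreal (s\<^sup>2) * I)"
      by (subst nn_integral_cmult, measurable)+ (simp only: mult.assoc)
    also have "ennreal (1/s) * ennreal (s\<^sup>2) = ennreal s"
      using s by (simp add: power2_eq_square flip: ennreal_mult')
    finally show "(\<integral>\<^sup>+x. ennreal (cmod (f y)) * (ennreal (1/s) * ennreal (cmod (f ((1 / s) *\<^sub>R (y - x))))) \<partial>lborel)
      = ennreal (cmod (f y)) * (ennreal s * I)" .
  qed
  also have "\<dots> = I * (ennreal s * I)"
    unfolding I_def by (rule nn_integral_multc) measurable
  also have "\<dots> = ennreal s * I\<^sup>2"
    by (simp only: power2_eq_square mult.left_commute)
  finally show ?thesis unfolding I_def .
qed

lemma scale_weightE:
  assumes "scale_weight v"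
  obtains w where "continuous_on {0<..} w" "\<forall>s>0. w s > 0" "\<forall>x. \<forall>s>0. v (x, s) = w s"
proof -
  have v: "affG_weight v" using assms by (simp add: scale_weight_def)
  obtain v0 where v0: "\<And>x s. s > 0 \<Longrightarrow> v (x, s) = v0 s" using assms by (auto simp: scale_weight_def)
  have "continuous_on {0<..} (\<lambda>s::real. v (0, s))"
  proof (rule continuous_on_compose2[of affG v])
    show "continuous_on affG v" using v by (simp add: affG_weight_def)
    show "continuous_on {0<..} (\<lambda>s::real. (0::real^2, s))" by (intro continuous_intros)
  qed (auto simp: affG_def)
  then show ?thesis
    using v v0 by (intro that[of "\<lambda>s. v (0, s)"]) (auto simp: affG_weight_def affG_def)
qed

lemma slice_measurable:
  fixes W :: "'a::euclidean_space \<times> 'b::euclidean_space \<Rightarrow> complex"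
  assumes "W \<in> borel_measurable borel" shows "(\<lambda>x. W (x, s)) \<in> borel_measurable borel"
proof (rule measurable_compose[OF _ assms])
  show "(\<lambda>x. (x, s)) \<in> borel_measurable borel"
    by (intro borel_measurable_continuous_onI continuous_intros)
qed

lemma nn_integral_weighted:
  fixes W :: "(real^2) \<times> real \<Rightarrow> complex"
  assumes [measurable]: "W \<in> borel_measurable borel"
    and w: "continuous_on {0<..} w" "\<forall>s>0. w s > 0" "\<forall>x. \<forall>s>0. v (x, s) = w s"
  shows "(\<lambda>z. cmod (W z) * v z) \<in> borel_measurable affG_haar"
    and "(\<integral>\<^sup>+z. ennreal (norm (cmod (W z) * v z)) \<partial>affG_haar)
      = (\<integral>\<^sup>+s. (\<integral>\<^sup>+x. ennreal (cmod (W (x, s))) \<partial>lborel) * (ennreal (w s / s^3) * indicator {0<..} s) \<partial>lborel)"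
proof -
  \<comment> \<open>Extending the weight by \<open>0\<close> makes it Borel on the whole space.\<close>
  define w' where "w' s = (if s \<in> {0<..} then w s else 0)" for s :: real
  have [measurable]: "w' \<in> borel_measurable borel"
    unfolding w'_def[abs_def] using w(1) by (intro borel_measurable_continuous_on_if) auto
  have [measurable]: "(\<lambda>z. w' (snd z)) \<in> borel_measurable (borel :: ((real^2) \<times> real) measure)"
    unfolding borel_prod[symmetric] by measurable
  have v: "v z = w' (snd z)" "w' (snd z) > 0" if "z \<in> affG" for z
    using that w(2,3) by (auto simp: affG_def w'_def)
  have "(\<lambda>z. cmod (W z) * w' (snd z)) \<in> borel_measurable affG_haar"
    by (rule borel_measurable_haarI) measurable
  then show "(\<lambda>z. cmod (W z) * v z) \<in> borel_measurable affG_haar"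
    by (rule measurable_cong[THEN iffD1, rotated]) (simp add: v)
  have "(\<integral>\<^sup>+z. ennreal (norm (cmod (W z) * v z)) \<partial>affG_haar)
    = (\<integral>\<^sup>+z. ennreal (cmod (W z)) * ennreal (w' (snd z)) \<partial>affG_haar)"
    using v by (intro nn_integral_cong) (simp add: abs_mult less_imp_le ennreal_mult)
  also have "\<dots> = (\<integral>\<^sup>+s. (\<integral>\<^sup>+x. ennreal (cmod (W (x, s))) * ennreal (w' s) \<partial>lborel) * (ennreal (1 / s^3) * indicator {0<..} s) \<partial>lborel)"
    by (subst nn_integral_haar) simp_all
  also have "\<dots> = (\<integral>\<^sup>+s. (\<integral>\<^sup>+x. ennreal (cmod (W (x, s))) \<partial>lborel) * (ennreal (w s / s^3) * indicator {0<..} s) \<partial>lborel)"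
  proof (intro nn_integral_cong)
    fix s :: real
    have "(\<lambda>x. W (x, s)) \<in> borel_measurable lborel"
      using slice_measurable[of W s] by simp
    then have "(\<integral>\<^sup>+x. ennreal (cmod (W (x, s))) * ennreal (w' s) \<partial>lborel) = (\<integral>\<^sup>+x. ennreal (cmod (W (x, s))) \<partial>lborel) * ennreal (w' s)"
      by (intro nn_integral_multc) measurable
    then show "(\<integral>\<^sup>+x. ennreal (cmod (W (x, s))) * ennreal (w' s) \<partial>lborel) * (ennreal (1 / s^3) * indicator {0<..} s)
      = (\<integral>\<^sup>+x. ennreal (cmod (W (x, s))) \<partial>lborel) * (ennreal (w s / s^3) * indicator {0<..} s)"
      using w(2)[rule_format, of s] by (simp add: indicator_def w'_def mult.assoc less_imp_le flip: ennreal_mult')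
  qed
  finally show "(\<integral>\<^sup>+z. ennreal (norm (cmod (W z) * v z)) \<partial>affG_haar)
      = (\<integral>\<^sup>+s. (\<integral>\<^sup>+x. ennreal (cmod (W (x, s))) \<partial>lborel) * (ennreal (w s / s^3) * indicator {0<..} s) \<partial>lborel)" .
qed

text \<open>The transform vanishes at scales outside \<open>[1/4, 4]\<close> because \<open>F\<close> is supported in \<open>1 \<le> norm \<xi> \<le> 4\<close>; inside
  this interval the slices have bounded \<open>L\<^sup>1\<close> norm and the weight is bounded.\<close>

lemma wavelet_FF_weighted_L1:
  assumes v: "scale_weight v"
  shows "wavelet_transform (ft Fhat) (ft Fhat) \<in> weighted_L1 v"
proof -
  let ?W = "wavelet_transform (ft Fhat) (ft Fhat)"
  note Linf_c_measurable[OF Linf_c_Fhat, measurable]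
  have W [measurable]: "?W \<in> borel_measurable borel" by measurable
  obtain w where w: "continuous_on {0<..} w" "\<forall>s>0. w s > 0" "\<forall>x. \<forall>s>0. v (x, s) = w s"
    by (rule scale_weightE[OF v]) blast
  note weighted = nn_integral_weighted[where v=v, OF W w]
  define I where "I = (\<integral>\<^sup>+y. ennreal (cmod (ft Fhat y)) \<partial>lborel)"
  have I: "I < \<infinity>" using integrable_ft_Fhat by (simp add: I_def integrable_iff_bounded)
  have "compact (w ` {1/4..4})"
    by (intro compact_continuous_image continuous_on_subset[OF w(1)]) auto
  then have "bounded (w ` {1/4..4})"
    by (rule compact_imp_bounded)
  then obtain V where "\<forall>y\<in>w ` {1/4..4}. norm y \<le> V"
    unfolding bounded_iff by blast
  then have V: "w s \<le> V" if "s \<in> {1/4..4}" for s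
  proof -
    have "norm (w s) \<le> V" using that \<open>\<forall>y\<in>w ` {1/4..4}. norm y \<le> V\<close> by blast
    then show ?thesis by simp
  qed
  have vanish: "?W (x, s) = 0" if s: "s > 0" "s \<notin> {1/4..4}" for x s
  proof -
    have "Fhat \<eta> * cnj (Fhat (s *\<^sub>R \<eta>)) = 0" for \<eta>
    proof (cases "norm \<eta> < 1 \<or> norm \<eta> > 4")
      case False
      then have "norm (s *\<^sub>R \<eta>) < 1 \<or> norm (s *\<^sub>R \<eta>) > 4"
      proof (cases "s < 1/4")
        case True
        then have "s * norm \<eta> < 1/4 * 4" using False s by (intro mult_less_le_imp_less) auto
        then show ?thesis using s by simp
      next
        case 2: False
        then have "4 * 1 < s * norm \<eta>" using False s by (intro mult_less_le_imp_less) auto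
        then show ?thesis using s by simp
      qed
      then show ?thesis by (simp add: Fhat_eq_0)
    qed (simp add: Fhat_eq_0)
    then show ?thesis
      unfolding wavelet_transform_of_ft[OF Linf_c_Fhat Linf_c_Fhat s(1)] ft_def
      by (simp only: mult_zero_left mult_zero_right integral_zero)
  qed
  have "(\<integral>\<^sup>+z. ennreal (norm (cmod (?W z) * v z)) \<partial>affG_haar)
    \<le> (\<integral>\<^sup>+s. (I\<^sup>2 * ennreal (16 * V)) * indicator {1/4..4::real} s \<partial>lborel)"
    unfolding weighted(2)
  proof (intro nn_integral_mono)
    fix s :: real
    show "(\<integral>\<^sup>+x. ennreal (cmod (?W (x, s))) \<partial>lborel) * (ennreal (w s / s^3) * indicator {0<..} s)
      \<le> (I\<^sup>2 * ennreal (16 * V)) * indicator {1/4..4} s"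
    proof (cases "s \<in> {1/4..4}")
      case True
      then have s: "s > 0" by simp
      have "s * (w s / s^3) = w s / s\<^sup>2"
        using s by (simp add: power2_eq_square power3_eq_cube)
      also have "\<dots> \<le> V / (1/4)\<^sup>2"
        using True V[OF True] w(2)[rule_format, OF s] by (intro frac_le power_mono) auto
      finally have c: "s * (w s / s^3) \<le> 16 * V" by (simp add: power2_eq_square)
      have "(\<integral>\<^sup>+x. ennreal (cmod (?W (x, s))) \<partial>lborel) * ennreal (w s / s^3) \<le> (ennreal s * I\<^sup>2) * ennreal (w s / s^3)"
        unfolding I_def by (intro mult_right_mono wavelet_L1_slice integrable_ft_Fhat s) simp
      also have "\<dots> = I\<^sup>2 * ennreal (s * (w s / s^3))"
        using s w(2)[rule_format, OF s] by (subst ennreal_mult) (auto simp: mult_ac)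
      also have "\<dots> \<le> I\<^sup>2 * ennreal (16 * V)"
        by (intro mult_left_mono ennreal_leI c) simp
      finally show ?thesis using True by simp
    next
      case False
      then show ?thesis using vanish[of s] by (cases "s > 0") auto
    qed
  qed
  also have "\<dots> < \<infinity>"
    using I by (simp add: nn_integral_cmult_indicator ennreal_mult_less_top power2_eq_square)
  finally have "integrable affG_haar (\<lambda>z. cmod (?W z) * v z)"
    using weighted(1) by (intro integrableI_bounded) auto
  then show ?thesis
    unfolding weighted_L1_def using borel_measurable_haarI[OF W] by simp
qed

text \<open>If the transform were integrable, inversion would extend \<open>(2\<pi>)\<^sup>2 H\<close> from the complement of the line
  \<open>\<eta>\<^sub>1 = 0\<close> to a continuous function \<open>K\<close>. But \<open>H\<close> equals \<open>P\<close> on one side and \<open>-P\<close> on the other, where \<open>P\<close> is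
  continuous and does not vanish at the point \<open>(0, 5/2)\<close>. The bounds on \<open>s\<close> keep \<open>p0\<close> and \<open>s p0\<close> in the
  annulus where \<open>F\<close> is known to be nonzero.\<close>

lemma not_integrable_slice:
  assumes s: "1 \<le> s" "s \<le> 11/10"
  shows "\<not> integrable lborel (ft (\<lambda>\<eta>. of_real s * (Ghat \<eta> * cnj (Fhat (s *\<^sub>R \<eta>)))))" 
proof
  define P where "P \<eta> = of_real s * (Fhat \<eta> * cnj (Fhat (s *\<^sub>R \<eta>)))" for \<eta>
  define H where "H \<eta> = of_real s * (Ghat \<eta> * cnj (Fhat (s *\<^sub>R \<eta>)))" for \<eta>
  assume "integrable lborel (ft (\<lambda>\<eta>. of_real s * (Ghat \<eta> * cnj (Fhat (s *\<^sub>R \<eta>)))))"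
  then have int: "integrable lborel (ft H)" by (simp add: H_def[abs_def])
  define K where "K p = ft (ft H) (- p)" for p
  have H_eq: "H \<eta> = half_sgn \<eta> * P \<eta>" for \<eta> by (simp add: H_def P_def Ghat_def)
  have Fs: "continuous_on UNIV (\<lambda>\<eta>. Fhat (s *\<^sub>R \<eta>))"
    by (rule continuous_on_compose2[OF Fhat_continuous]) (auto intro!: continuous_intros)
  have P_cont: "continuous_on UNIV P"
    unfolding P_def by (intro continuous_intros Fs Fhat_continuous)
  have H: "H \<in> Linf_c"
  proof -
    obtain M R where M: "\<And>x. cmod (Fhat x) \<le> M" by (rule Linf_cE[OF Linf_c_Fhat]) blast
    note Linf_c_measurable[OF Linf_c_Fhat, measurable]
    show ?thesis
      unfolding H_def[abs_def]
      by (intro Linf_c_cmult Linf_c_mult[of _ _ M] Linf_c_Ghat) (auto simp: M)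
  qed
  have K_cont: "continuous_on UNIV K"
    unfolding K_def by (rule continuous_on_compose2[OF ft_continuous[OF int]]) (auto intro!: continuous_intros)
  have pos: "(2*pi)\<^sup>2 * P p = K p" if "p $ 1 > 0" for p
  proof -
    have "continuous_on {p. p $ 1 > 0} H"
      by (rule continuous_on_eq[OF continuous_on_subset[OF P_cont]]) (auto simp: H_eq half_sgn_def)
    then have "isCont H p"
      using that by (subst (asm) continuous_on_eq_continuous_at) (auto intro: open_halfspace_component_gt_cart)
    from ft_inversion_at_continuity[OF H int this] that show ?thesis
      by (simp add: K_def H_eq half_sgn_def)
  qed
  have neg: "- ((2*pi)\<^sup>2 * P p) = K p" if "p $ 1 < 0" for p
  proof -
    have "continuous_on {p. p $ 1 < 0} H"
      by (rule continuous_on_eq[OF continuous_on_minus[OF continuous_on_subset[OF P_cont]]]) (auto simp: H_eq half_sgn_def)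
    then have "isCont H p"
      using that by (subst (asm) continuous_on_eq_continuous_at) (auto intro: open_halfspace_component_lt_cart)
    from ft_inversion_at_continuity[OF H int this] that show ?thesis
      by (simp add: K_def H_eq half_sgn_def)
  qed
  define p0 :: "real^2" where "p0 = (5/2) *\<^sub>R axis 2 1"
  have lim: "(\<lambda>n. Q (p0 + (c / real (Suc n)) *\<^sub>R axis 1 1)) \<longlonglongrightarrow> Q p0" if "continuous_on UNIV Q" for Q :: "real^2 \<Rightarrow> complex" and c
  proof -
    have "isCont Q p0" using that by (simp add: continuous_on_eq_continuous_at)
    moreover have "(\<lambda>n. p0 + (c * (1 / real (Suc n))) *\<^sub>R axis 1 1) \<longlonglongrightarrow> p0 + (c * 0) *\<^sub>R axis 1 1"
      by (intro tendsto_intros LIMSEQ_Suc[OF lim_1_over_n])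
    ultimately show ?thesis
      using isCont_tendsto_compose[of p0 Q] by simp
  qed
  have "K p0 = (2*pi)\<^sup>2 * P p0"
  proof (rule LIMSEQ_unique)
    show "(\<lambda>n. K (p0 + (1 / real (Suc n)) *\<^sub>R axis 1 1)) \<longlonglongrightarrow> K p0"
      by (rule lim[OF K_cont])
    have "(\<lambda>n. (2*pi)\<^sup>2 * P (p0 + (1 / real (Suc n)) *\<^sub>R axis 1 1)) \<longlonglongrightarrow> (2*pi)\<^sup>2 * P p0"
      by (intro tendsto_intros lim[OF P_cont])
    then show "(\<lambda>n. K (p0 + (1 / real (Suc n)) *\<^sub>R axis 1 1)) \<longlonglongrightarrow> (2*pi)\<^sup>2 * P p0"
      by (subst (asm) pos) (simp_all add: p0_def axis_def)
  qed
  moreover have "K p0 = - ((2*pi)\<^sup>2 * P p0)"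
  proof (rule LIMSEQ_unique)
    show "(\<lambda>n. K (p0 + (-1 / real (Suc n)) *\<^sub>R axis 1 1)) \<longlonglongrightarrow> K p0"
      by (rule lim[OF K_cont])
    have "(\<lambda>n. - ((2*pi)\<^sup>2 * P (p0 + (-1 / real (Suc n)) *\<^sub>R axis 1 1))) \<longlonglongrightarrow> - ((2*pi)\<^sup>2 * P p0)"
      by (intro tendsto_intros lim[OF P_cont])
    then show "(\<lambda>n. K (p0 + (-1 / real (Suc n)) *\<^sub>R axis 1 1)) \<longlonglongrightarrow> - ((2*pi)\<^sup>2 * P p0)"
      by (subst (asm) neg) (simp_all add: p0_def axis_def)
  qed
  ultimately have "P p0 = 0" by (simp add: eq_neg_iff_add_eq_0)
  moreover have "Fhat p0 \<noteq> 0" "Fhat (s *\<^sub>R p0) \<noteq> 0"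
    using s Fhat_nonzero[of p0] Fhat_nonzero[of "s *\<^sub>R p0"] by (auto simp: p0_def)
  ultimately show False using s by (simp add: P_def)
qed

lemma wavelet_FG_not_weighted_L1:
  assumes v: "scale_weight v"
  shows "wavelet_transform (ft Fhat) (ft Ghat) \<notin> weighted_L1 v"
proof
  let ?W = "wavelet_transform (ft Fhat) (ft Ghat)"
  assume *: "?W \<in> weighted_L1 v"
  note Linf_c_measurable[OF Linf_c_Fhat, measurable] Linf_c_measurable[OF Linf_c_Ghat, measurable]
  have W [measurable]: "?W \<in> borel_measurable borel" by measurable
  have [measurable]: "(\<lambda>(x, s). ?W (x, s)) \<in> borel_measurable (borel \<Otimes>\<^sub>M borel)"
    unfolding borel_prod by simp
  obtain w where w: "continuous_on {0<..} w" "\<forall>s>0. w s > 0" "\<forall>x. \<forall>s>0. v (x, s) = w s"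
    by (rule scale_weightE[OF v]) blast
  define J where "J s = (\<integral>\<^sup>+x. ennreal (cmod (?W (x, s))) \<partial>lborel)" for s
  have J_top: "J s = \<infinity>" if s: "s \<in> {1..11/10}" for s
  proof (rule ccontr)
    assume "J s \<noteq> \<infinity>"
    moreover have "(\<lambda>x. ?W (x, s)) \<in> borel_measurable lborel"
      using slice_measurable[OF W] by simp
    ultimately have "integrable lborel (\<lambda>x. ?W (x, s))"
      by (intro integrableI_bounded) (auto simp: J_def less_top)
    then have "integrable lborel (\<lambda>x. 1 / (2*pi)\<^sup>2 * ?W (x, s))"
      by (rule integrable_mult_right)
    then have "integrable lborel (ft (\<lambda>\<eta>. of_real s * (Ghat \<eta> * cnj (Fhat (s *\<^sub>R \<eta>)))))"
      using s by (simp add: wavelet_transform_of_ft[OF Linf_c_Fhat Linf_c_Ghat])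
    with not_integrable_slice[of s] s show False by auto
  qed
  have "\<infinity> = (\<integral>\<^sup>+s. \<infinity> * indicator {1..11/10::real} s \<partial>lborel)"
    by (subst nn_integral_cmult_indicator) (simp_all add: ennreal_top_mult)
  also have "\<dots> \<le> (\<integral>\<^sup>+s. J s * (ennreal (w s / s^3) * indicator {0<..} s) \<partial>lborel)"
  proof (intro nn_integral_mono)
    fix s :: real
    show "\<infinity> * indicator {1..11/10} s \<le> J s * (ennreal (w s / s^3) * indicator {0<..} s)"
    proof (cases "s \<in> {1..11/10}")
      case True
      then have "ennreal (w s / s^3) \<noteq> 0" using w(2)[rule_format, of s] by (simp add: ennreal_eq_0_iff not_le)
      then show ?thesis using True J_top[OF True] by (simp add: ennreal_top_mult)
    qed simp
  qed
  also have "\<dots> = (\<integral>\<^sup>+z. ennreal (norm (cmod (?W z) * v z)) \<partial>affG_haar)"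
    unfolding J_def by (rule nn_integral_weighted(2)[where v=v, OF W w, symmetric])
  also have "\<dots> < \<infinity>"
    using * by (simp add: weighted_L1_def integrable_iff_bounded)
  finally show False by simp
qed

lemma weighted_L1_cong:
  assumes "\<And>z. z \<in> affG \<Longrightarrow> F z = G z"
  shows "F \<in> weighted_L1 v \<longleftrightarrow> G \<in> weighted_L1 v"
proof -
  have "F \<in> borel_measurable affG_haar \<longleftrightarrow> G \<in> borel_measurable affG_haar"
    using assms by (intro measurable_cong) simp
  moreover have "integrable affG_haar (\<lambda>z. cmod (F z) * v z) \<longleftrightarrow> integrable affG_haar (\<lambda>z. cmod (G z) * v z)"
    using assms by (intro Bochner_Integration.integrable_cong refl) simp
  ultimately show ?thesis by (simp add: weighted_L1_def)
qed

theorem mainTheorem11: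
  "\<exists>f g :: real^2 \<Rightarrow> complex.
     f \<in> L2_fun lborel \<and> g \<in> L2_fun lborel \<and>
     isometric_wavelet f \<and> isometric_wavelet g \<and>
     (\<forall>z\<in>affG. wavelet_transform g g z = wavelet_transform f f z) \<and>
     (\<forall>v. scale_weight v \<longrightarrow> wavelet_transform f f \<in> weighted_L1 v) \<and>
     (\<forall>v. scale_weight v \<longrightarrow> wavelet_transform f g \<notin> weighted_L1 v) \<and>
     (\<forall>v. scale_weight v \<longrightarrow> coorbit_L1 f v \<noteq> coorbit_L1 g v)"
proof (rule exI[of _ "ft Fhat"], rule exI[of _ "ft Ghat"], intro conjI allI impI ballI)
  show "isometric_wavelet (ft Fhat)" "isometric_wavelet (ft Ghat)"
    by (intro isometric_wavelet_ft Linf_c_Fhat Linf_c_Ghat admissible_Fhat admissible_Ghat)+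
  fix v assume v: "scale_weight v"
  have "wavelet_transform (ft Ghat) (ft Ghat) \<in> weighted_L1 v"
    using wavelet_FF_weighted_L1[OF v] weighted_L1_cong[of "wavelet_transform (ft Ghat) (ft Ghat)"] wavelet_GG_eq_FF by blast
  then have "ft Ghat \<in> coorbit_L1 (ft Ghat) v" "ft Ghat \<notin> coorbit_L1 (ft Fhat) v"
    using wavelet_FG_not_weighted_L1[OF v] by (auto simp: coorbit_L1_def L2_ft Linf_c_Ghat)
  then show "coorbit_L1 (ft Fhat) v \<noteq> coorbit_L1 (ft Ghat) v" by blast
qed (use L2_ft Linf_c_Fhat Linf_c_Ghat wavelet_GG_eq_FF wavelet_FF_weighted_L1 wavelet_FG_not_weighted_L1 in blast)+

end
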